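(* Let $\sigma>0$, $\epsilon\in(0,1)$ and $\delta\in(0,1]$. For the AWGN channel $Y_i=X_i+Z_i$, $i=1,\ldots,n$, where the $Z_i$ are i.i.d. centered Gaussian random variables with standard deviation $\sigma$, independent of the input, the covert capacity $L_{\epsilon,\delta}$ under average error probability $\epsilon$ and Kullback-Leibler covertness level $\delta$ satisfies $$L_{\epsilon,\delta}\geq \frac{\sqrt{\delta}}{\sqrt{1-\epsilon}}.$$
   Context: All logarithms are natural. Fix $\sigma>0$. The AWGN channel of blocklength $n$ maps an input $x^n\in\mathbb{R}^n$ to the output $Y^n=x^n+Z^n$, where $Z^n=(Z_1,\ldots,Z_n)$ has i.i.d. components that are Gaussian with mean $0$ and standard deviation $\sigma$ (variance $\sigma^2$), independent of the input; $P_{Y^n|X^n}(\cdot|x^n)$ denotes the law of $x^n+Z^n$ and $P_{Z^n}$ the law of $Z^n$. The legitimate receiver and the eavesdropper observe the same output $Y^n$. A code $\mathcal{C}=(f,g)$ of length $n$ for a finite nonempty message set $\mathcal{M}$ and a finite nonempty key set $\mathcal{K}$ consists of an encoder $f\colon\mathcal{M}\times\mathcal{K}\to\mathbb{R}^n$ and a (measurable) decoder $g\colon\mathbb{R}^n\times\mathcal{K}\to\mathcal{M}$. Several pairs $(w,k)$ may be mapped to the same codeword. The message and the key are independent and uniformly distributed; the key is known to the transmitter and the receiver but not to the eavesdropper. The size of $\mathcal{K}$ is unconstrained (it may be taken as large as needed). The average error probability is $$P_e^{\mathrm{avg}}=\frac{1}{|\mathcal{K}||\mathcal{M}|}\sum_{k\in\mathcal{K}}\sum_{w\in\mathcal{M}}\mathbb{P}\left[g(f(w,k)+Z^n,k)\neq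 w\right].$$ The output distribution induced by the code is $$P_{Y^n_{\mathcal{C}}}(\cdot)=\frac{1}{|\mathcal{K}||\mathcal{M}|}\sum_{k\in\mathcal{K}}\sum_{w\in\mathcal{M}}P_{Y^n|X^n}(\cdot|f(w,k)).$$ The Kullback-Leibler divergence is $D(P_1\|P_2)=\int \ln\left(\frac{dP_1}{dP_2}\right)dP_1$. An $(n,M,\epsilon,\delta)$-code is a code of length $n$ with $|\mathcal{M}|=M$ (and some finite key set) such that $P_e^{\mathrm{avg}}\leq\epsilon$ and $D(P_{Y^n_{\mathcal{C}}}\|P_{Z^n})\leq\delta$. Let $$M^*(n,\epsilon,\delta)=\max\{M : \text{there exists an }(n,M,\epsilon,\delta)\text{-code}\}.$$ The covert capacity is $$L_{\epsilon,\delta}=\liminf_{n\to+\infty}\frac{\ln\left(M^*(n,\epsilon,\delta)\right)}{\sqrt{n}}.$$ *)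

theory Defs
  imports "HOL-Probability.Probability"
begin

(* R^n is carried by the extensional functions on {..<n}, with the product Borel sigma-algebra. *)
definition euclid :: "nat \<Rightarrow> (nat \<Rightarrow> real) measure" where
  "euclid n = (\<Pi>\<^sub>M i\<in>{..<n}. borel)"

definition vec_add :: "nat \<Rightarrow> (nat \<Rightarrow> real) \<Rightarrow> (nat \<Rightarrow> real) \<Rightarrow> nat \<Rightarrow> real" where
  "vec_add n x z = (\<lambda>i\<in>{..<n}. x i + z i)"

definition noise :: "real \<Rightarrow> nat \<Rightarrow> (nat \<Rightarrow> real) measure" where
  "noise \<sigma> n = (\<Pi>\<^sub>M i\<in>{..<n}. density lborel (\<lambda>z. ennreal (normal_density 0 \<sigma> z)))"

definition awgn :: "real \<Rightarrow> nat \<Rightarrow> (nat \<Rightarrow> real) \<Rightarrow> (nat \<Rightarrow> real) measure" where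
  "awgn \<sigma> n x = distr (noise \<sigma> n) (euclid n) (vec_add n x)"

(* Messages and keys are labelled by natural numbers: only the cardinalities of the finite
   sets W and K matter. *)
definition code ::
  "nat \<Rightarrow> nat set \<Rightarrow> nat set \<Rightarrow> (nat \<times> nat \<Rightarrow> nat \<Rightarrow> real) \<Rightarrow> ((nat \<Rightarrow> real) \<times> nat \<Rightarrow> nat) \<Rightarrow> bool"
  where
  "code n W K f g \<longleftrightarrow>
     finite W \<and> W \<noteq> {} \<and> finite K \<and> K \<noteq> {} \<and>
     f \<in> W \<times> K \<rightarrow> space (euclid n) \<and>
     g \<in> measurable (euclid n \<Otimes>\<^sub>M count_space K) (count_space W)"

definition avg_error ::
  "real \<Rightarrow> nat \<Rightarrow> nat set \<Rightarrow> nat set \<Rightarrow> (nat \<times> nat \<Rightarrow> nat \<Rightarrow> real) \<Rightarrow> ((nat \<Rightarrow> real) \<times> nat \<Rightarrow> nat) \<Rightarrow> real"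
  where
  "avg_error \<sigma> n W K f g =
     1 / (real (card K) * real (card W)) *
     (\<Sum>k\<in>K. \<Sum>w\<in>W. measure (noise \<sigma> n)
        {z \<in> space (noise \<sigma> n). g (vec_add n (f (w, k)) z, k) \<noteq> w})"

definition output_dist ::
  "real \<Rightarrow> nat \<Rightarrow> nat set \<Rightarrow> nat set \<Rightarrow> (nat \<times> nat \<Rightarrow> nat \<Rightarrow> real) \<Rightarrow> (nat \<Rightarrow> real) measure"
  where
  "output_dist \<sigma> n W K f =
     measure_of (space (euclid n)) (sets (euclid n))
       (\<lambda>A. ennreal (1 / (real (card K) * real (card W))) *
            (\<Sum>k\<in>K. \<Sum>w\<in>W. emeasure (awgn \<sigma> n (f (w, k))) A))"

(* KL_divergence b M N is D(N || M) with logarithms to base b.  A Bochner integral is 0 on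
   non-integrable functions, but here N is a finite mixture of translates of the Gaussian M,
   so the log-density is N-integrable and the value is the true divergence. *)
definition is_code :: "real \<Rightarrow> nat \<Rightarrow> nat \<Rightarrow> real \<Rightarrow> real \<Rightarrow> bool" where
  "is_code \<sigma> n M \<epsilon> \<delta> \<longleftrightarrow>
     (\<exists>W K f g. code n W K f g \<and> card W = M \<and>
        avg_error \<sigma> n W K f g \<le> \<epsilon> \<and>
        KL_divergence (exp 1) (noise \<sigma> n) (output_dist \<sigma> n W K f) \<le> \<delta>)"

(* Max is unspecified on infinite or empty sets; for \<sigma> > 0, 0 \<le> \<epsilon> < 1 and \<delta> \<ge> 0 the set is nonempty
   (the single-message code sending 0) and finite (bounded divergence bounds the average power). *)
definition M_star :: "real \<Rightarrow> nat \<Rightarrow> real \<Rightarrow> real \<Rightarrow> nat" where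
  "M_star \<sigma> n \<epsilon> \<delta> = Max {M. is_code \<sigma> n M \<epsilon> \<delta>}"

definition covert_capacity :: "real \<Rightarrow> real \<Rightarrow> real \<Rightarrow> ereal" where
  "covert_capacity \<sigma> \<epsilon> \<delta> =
     liminf (\<lambda>n. ereal (ln (real (M_star \<sigma> n \<epsilon> \<delta>)) / sqrt (real n)))"

end

theory Submission
  imports Defs "HOL-Real_Asymp.Real_Asymp"
begin

text \<open>
  The key selects the codebook: it ranges over all maps from messages to sign vectors, together
  with a flag which, for a rational fraction \<open>q < \<epsilon>\<close> of the keys, replaces every codeword by zero.
  Averaging over the keys therefore is random coding with binary antipodal inputs, and the output
  law is exactly \<open>q Q + (1 - q) P\<close> with \<open>Q\<close> the noise law and \<open>P\<close> a product of symmetric two-point Gaussian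
  mixtures; no resolvability argument is needed. With amplitude \<open>v \<sigma>\<close> per letter and \<open>v\<^sup>2 = 2 u / sqrt n\<close>,
  convexity of \<open>x ln x\<close> and the expansion of \<open>ln cosh\<close> up to order six bound the divergence by
  \<open>(1 - q) u\<^sup>2 + o(1)\<close>. Thresholding the likelihood ratio against the noise law, a Chernoff bound for
  missing the true codeword and a Markov bound for the false alarms give error at most \<open>q + o(1)\<close>
  at every rate below \<open>u sqrt n\<close>; letting \<open>q\<close> increase to \<open>\<epsilon>\<close>, \<open>u\<close> may be taken arbitrarily close to
  \<open>sqrt (\<delta> / (1 - \<epsilon>))\<close>.

  Since \<open>M_star\<close> is a maximum, the set of admissible sizes must also be shown finite: bounded
  divergence confines most of the output mass to a fixed ball, on which likelihood ratios are
  bounded uniformly in the codeword, so disjoint decoding regions limit the number of messages.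
\<close>

section \<open>Gaussian likelihood ratios\<close>

definition gauss :: "real \<Rightarrow> real measure" where
  "gauss \<sigma> = density lborel (\<lambda>z. ennreal (normal_density 0 \<sigma> z))"

text \<open>The density of the output law of codeword \<open>x\<close> with respect to pure noise,
  as \<open>awgn_density\<close> confirms. Its product form matches that of \<open>noise\<close>, so
  that integrals factor.\<close>

definition lr :: "real \<Rightarrow> nat \<Rightarrow> (nat \<Rightarrow> real) \<Rightarrow> (nat \<Rightarrow> real) \<Rightarrow> real" where
  "lr \<sigma> n x y = (\<Prod>i<n. exp ((x i * y i - (x i)\<^sup>2 / 2) / \<sigma>\<^sup>2))"

lemma lr_eq_exp: "lr \<sigma> n x y = exp (\<Sum>i<n. (x i * y i - (x i)\<^sup>2 / 2) / \<sigma>\<^sup>2)"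
  by (simp add: lr_def exp_sum)

lemma lr_pos: "0 < lr \<sigma> n x y"
  by (simp add: lr_eq_exp)

lemma lr_nonneg [simp]: "0 \<le> lr \<sigma> n x y"
  by (simp add: lr_eq_exp)

lemma lr_zero [simp]: "lr \<sigma> n (\<lambda>i\<in>{..<n}. 0) y = 1"
  by (simp add: lr_def)

lemma sets_gauss [simp, measurable_cong]: "sets (gauss \<sigma>) = sets borel"
  and space_gauss [simp]: "space (gauss \<sigma>) = UNIV"
  by (simp_all add: gauss_def)

lemma noise_eq: "noise \<sigma> n = (\<Pi>\<^sub>M i\<in>{..<n}. gauss \<sigma>)"
  by (simp add: noise_def gauss_def)

lemma sets_noise: "sets (noise \<sigma> n) = sets (euclid n)"
  unfolding noise_eq euclid_def by (intro sets_PiM_cong) auto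

lemma sets_noise_PiM [measurable_cong]: "sets (noise \<sigma> n) = sets (\<Pi>\<^sub>M i\<in>{..<n}. borel)"
  using sets_noise by (simp add: euclid_def)

lemma sets_euclid [measurable_cong]: "sets (euclid n) = sets (\<Pi>\<^sub>M i\<in>{..<n}. borel)"
  by (simp add: euclid_def)

lemma space_noise: "space (noise \<sigma> n) = space (euclid n)"
  using sets_noise by (rule sets_eq_imp_space_eq)

lemma space_euclid: "space (euclid n) = {..<n} \<rightarrow>\<^sub>E UNIV"
  by (simp add: euclid_def space_PiM)

lemma lr_measurable_borel [measurable]: "lr \<sigma> n x \<in> borel_measurable (\<Pi>\<^sub>M i\<in>{..<n}. borel)"
  unfolding lr_def[abs_def] by measurable

lemma vec_add_measurable [measurable]:
  "vec_add n x \<in> measurable (\<Pi>\<^sub>M i\<in>{..<n}. borel) (\<Pi>\<^sub>M i\<in>{..<n}. borel)"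
  unfolding vec_add_def[abs_def] by measurable

context
  fixes \<sigma> :: real
  assumes \<sigma>_pos: "0 < \<sigma>"
begin

lemma prob_space_gauss: "prob_space (gauss \<sigma>)"
  unfolding gauss_def by (rule prob_space_normal_density[OF \<sigma>_pos])

lemma product_sigma_finite_gauss: "product_sigma_finite (\<lambda>i. gauss \<sigma>)"
  unfolding product_sigma_finite_def
  using prob_space_gauss prob_space_imp_sigma_finite by blast

lemma prob_space_noise: "prob_space (noise \<sigma> n)"
  unfolding noise_eq by (intro prob_space_PiM prob_space_gauss)

section \<open>Gaussian integrals of exponentials and of likelihood ratios\<close>

lemma normal_density_shift:
  "normal_density 0 \<sigma> z * exp ((x * z - x\<^sup>2 / 2) / \<sigma>\<^sup>2) = normal_density x \<sigma> z"
proof -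
  have "- (z - 0)\<^sup>2 / (2 * \<sigma>\<^sup>2) + (x * z - x\<^sup>2 / 2) / \<sigma>\<^sup>2 = - (z - x)\<^sup>2 / (2 * \<sigma>\<^sup>2)"
    using \<sigma>_pos by (simp add: field_simps power2_eq_square)
  then show ?thesis
    unfolding normal_density_def by (simp add: exp_add[symmetric])
qed

lemma has_bochner_integral_gauss:
  assumes "has_bochner_integral lborel (\<lambda>z. normal_density 0 \<sigma> z * f z) (r::real)"
    and [measurable]: "f \<in> borel_measurable borel"
  shows "has_bochner_integral (gauss \<sigma>) f r"
  unfolding gauss_def
  by (rule has_bochner_integral_density) (use assms in auto)

text \<open>Completing the square turns exp (c z) times the density into a multiple of the normal
  density centred at \<sigma>^2 c, whose total mass is one.\<close>

lemma gauss_exp: "has_bochner_integral (gauss \<sigma>) (\<lambda>z. exp (c * z)) (exp (\<sigma>\<^sup>2 * c\<^sup>2 / 2))"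
proof (rule has_bochner_integral_gauss)
  have eq: "normal_density 0 \<sigma> z * exp (c * z) = exp (\<sigma>\<^sup>2 * c\<^sup>2 / 2) * normal_density (\<sigma>\<^sup>2 * c) \<sigma> z" for z
  proof -
    have "c * z = \<sigma>\<^sup>2 * c\<^sup>2 / 2 + (\<sigma>\<^sup>2 * c * z - (\<sigma>\<^sup>2 * c)\<^sup>2 / 2) / \<sigma>\<^sup>2"
      using \<sigma>_pos by (simp add: diff_divide_distrib power2_eq_square)
    then have "exp (c * z) = exp (\<sigma>\<^sup>2 * c\<^sup>2 / 2) * exp ((\<sigma>\<^sup>2 * c * z - (\<sigma>\<^sup>2 * c)\<^sup>2 / 2) / \<sigma>\<^sup>2)"
      by (simp only: exp_add[symmetric])
    then show ?thesis
      by (subst (2) normal_density_shift[symmetric]) simp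
  qed
  have "has_bochner_integral lborel (\<lambda>z. exp (\<sigma>\<^sup>2 * c\<^sup>2 / 2) * normal_density (\<sigma>\<^sup>2 * c) \<sigma> z)
     (exp (\<sigma>\<^sup>2 * c\<^sup>2 / 2) * 1)"
    using \<sigma>_pos by (intro has_bochner_integral_mult_right) (simp add: has_bochner_integral_iff)
  then show "has_bochner_integral lborel (\<lambda>z. normal_density 0 \<sigma> z * exp (c * z)) (exp (\<sigma>\<^sup>2 * c\<^sup>2 / 2))"
    unfolding eq mult_1_right .
qed simp

lemma has_bochner_integral_noise_prod:
  fixes f :: "nat \<Rightarrow> real \<Rightarrow> real"
  assumes "\<And>i. i < n \<Longrightarrow> has_bochner_integral (gauss \<sigma>) (f i) (r i)"
  shows "has_bochner_integral (noise \<sigma> n) (\<lambda>z. \<Prod>i<n. f i (z i)) (\<Prod>i<n. r i)"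
proof -
  interpret product_sigma_finite "\<lambda>i. gauss \<sigma>" by (rule product_sigma_finite_gauss)
  have int: "integrable (gauss \<sigma>) (f i)" "integral\<^sup>L (gauss \<sigma>) (f i) = r i" if "i \<in> {..<n}" for i
    using assms[of i] that by (auto simp: has_bochner_integral_iff)
  have "integral\<^sup>L (noise \<sigma> n) (\<lambda>z. \<Prod>i<n. f i (z i)) = (\<Prod>i<n. integral\<^sup>L (gauss \<sigma>) (f i))"
    unfolding noise_eq by (intro product_integral_prod int) auto
  also have "\<dots> = (\<Prod>i<n. r i)"
    by (intro prod.cong int) auto
  finally show ?thesis
    unfolding has_bochner_integral_iff noise_eq by (intro conjI product_integrable_prod int) auto
qed

lemma noise_exp:
  "has_bochner_integral (noise \<sigma> n) (\<lambda>z. exp (\<Sum>i<n. c i * z i)) (exp (\<sigma>\<^sup>2 / 2 * (\<Sum>i<n. (c i)\<^sup>2)))"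
proof -
  have eq: "\<sigma>\<^sup>2 / 2 * (\<Sum>i<n. (c i)\<^sup>2) = (\<Sum>i<n. \<sigma>\<^sup>2 * (c i)\<^sup>2 / 2)"
    unfolding sum_distrib_left by (intro sum.cong) auto
  show ?thesis
    unfolding eq exp_sum[OF finite_lessThan]
    by (intro has_bochner_integral_noise_prod gauss_exp)
qed

text \<open>A power of \<open>lr\<close> is a constant times the exponential of a linear form with
  coefficients t x_i / \<sigma>^2, to which \<open>noise_exp\<close> applies. The case t = 1
  normalises \<open>lr\<close>; t = 1 - s yields the Chernoff bound of the decoder.\<close>

lemma lr_powr_integral:
  "has_bochner_integral (noise \<sigma> n) (\<lambda>z. lr \<sigma> n x z powr t)
     (exp ((t\<^sup>2 - t) * (\<Sum>i<n. (x i)\<^sup>2) / (2 * \<sigma>\<^sup>2)))"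
proof -
  define S where "S = (\<Sum>i<n. (x i)\<^sup>2)"
  have "has_bochner_integral (noise \<sigma> n)
      (\<lambda>z. exp (- t * S / (2 * \<sigma>\<^sup>2)) * exp (\<Sum>i<n. (t * x i / \<sigma>\<^sup>2) * z i))
      (exp (- t * S / (2 * \<sigma>\<^sup>2)) * exp (\<sigma>\<^sup>2 / 2 * (\<Sum>i<n. (t * x i / \<sigma>\<^sup>2)\<^sup>2)))"
    by (intro has_bochner_integral_mult_right noise_exp)
  moreover have "exp (- t * S / (2 * \<sigma>\<^sup>2)) * exp (\<Sum>i<n. (t * x i / \<sigma>\<^sup>2) * z i) = lr \<sigma> n x z powr t" for z
  proof -
    have "(\<Sum>i<n. (t * x i / \<sigma>\<^sup>2) * z i) =
        (\<Sum>i<n. t * ((x i * z i - (x i)\<^sup>2 / 2) / \<sigma>\<^sup>2) + t / (2 * \<sigma>\<^sup>2) * (x i)\<^sup>2)"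
      using \<sigma>_pos by (intro sum.cong refl) (simp add: field_simps)
    also have "\<dots> = t * (\<Sum>i<n. (x i * z i - (x i)\<^sup>2 / 2) / \<sigma>\<^sup>2) + t / (2 * \<sigma>\<^sup>2) * S"
      by (simp only: sum.distrib S_def sum_distrib_left)
    finally show ?thesis by (simp add: lr_eq_exp powr_def exp_add[symmetric])
  qed
  moreover have "\<sigma>\<^sup>2 / 2 * (\<Sum>i<n. (t * x i / \<sigma>\<^sup>2)\<^sup>2) = t\<^sup>2 / (2 * \<sigma>\<^sup>2) * S"
    unfolding S_def sum_distrib_left
    using \<sigma>_pos by (intro sum.cong refl) (simp add: field_simps power2_eq_square)
  then have "- t * S / (2 * \<sigma>\<^sup>2) + \<sigma>\<^sup>2 / 2 * (\<Sum>i<n. (t * x i / \<sigma>\<^sup>2)\<^sup>2) = (t\<^sup>2 - t) * S / (2 * \<sigma>\<^sup>2)"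
    by (simp add: left_diff_distrib diff_divide_distrib)
  ultimately show ?thesis by (simp add: exp_add[symmetric] S_def)
qed

text \<open>This is the mean of the likelihood ratio of \<open>x'\<close> when \<open>x\<close> is
  sent. It depends on the codewords only through their inner product, which is later averaged over
  codebooks.\<close>

lemma lr_mult_integral:
  "has_bochner_integral (noise \<sigma> n) (\<lambda>z. lr \<sigma> n x z * lr \<sigma> n x' z) (exp ((\<Sum>i<n. x i * x' i) / \<sigma>\<^sup>2))"
proof -
  define S where "S = (\<Sum>i<n. ((x i)\<^sup>2 + (x' i)\<^sup>2) / (2 * \<sigma>\<^sup>2))"
  have lr: "lr \<sigma> n x z * lr \<sigma> n x' z = exp (- S) * exp (\<Sum>i<n. ((x i + x' i) / \<sigma>\<^sup>2) * z i)" for z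
  proof -
    have "(\<Sum>i<n. ((x i + x' i) / \<sigma>\<^sup>2) * z i) =
      (\<Sum>i<n. (x i * z i - (x i)\<^sup>2 / 2) / \<sigma>\<^sup>2 + (x' i * z i - (x' i)\<^sup>2 / 2) / \<sigma>\<^sup>2
         + ((x i)\<^sup>2 + (x' i)\<^sup>2) / (2 * \<sigma>\<^sup>2))"
      using \<sigma>_pos by (intro sum.cong refl) (simp add: field_simps)
    then show ?thesis by (simp add: lr_eq_exp exp_add[symmetric] sum.distrib S_def)
  qed
  have "\<sigma>\<^sup>2 / 2 * (\<Sum>i<n. ((x i + x' i) / \<sigma>\<^sup>2)\<^sup>2) =
     (\<Sum>i<n. x i * x' i / \<sigma>\<^sup>2 + ((x i)\<^sup>2 + (x' i)\<^sup>2) / (2 * \<sigma>\<^sup>2))"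
    unfolding sum_distrib_left
    using \<sigma>_pos by (intro sum.cong refl) (simp add: field_simps power2_eq_square)
  also have "\<dots> = (\<Sum>i<n. x i * x' i) / \<sigma>\<^sup>2 + S"
    by (simp only: sum.distrib S_def sum_divide_distrib)
  finally have "(\<Sum>i<n. x i * x' i) / \<sigma>\<^sup>2 = - S + \<sigma>\<^sup>2 / 2 * (\<Sum>i<n. ((x i + x' i) / \<sigma>\<^sup>2)\<^sup>2)"
    by linarith
  then have v: "exp ((\<Sum>i<n. x i * x' i) / \<sigma>\<^sup>2) =
      exp (- S) * exp (\<sigma>\<^sup>2 / 2 * (\<Sum>i<n. ((x i + x' i) / \<sigma>\<^sup>2)\<^sup>2))"
    by (simp only: exp_add)
  show ?thesis
    unfolding lr v by (intro has_bochner_integral_mult_right noise_exp)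
qed

lemma lr_integral: "has_bochner_integral (noise \<sigma> n) (lr \<sigma> n x) 1"
proof -
  have "(\<lambda>z. lr \<sigma> n x z powr 1) = lr \<sigma> n x" by (rule ext) (simp add: powr_one)
  moreover have "exp ((1\<^sup>2 - 1) * (\<Sum>i<n. (x i)\<^sup>2) / (2 * \<sigma>\<^sup>2)) = 1" by simp
  ultimately show ?thesis using lr_powr_integral[of n x 1] by (simp only:)
qed

section \<open>Change of measure from noise to channel output\<close>

lemma emeasure_gauss_shift:
  assumes [measurable]: "A \<in> sets borel"
  shows "emeasure (gauss \<sigma>) ((\<lambda>z. x + z) -` A) =
    (\<integral>\<^sup>+z. ennreal (exp ((x * z - x\<^sup>2 / 2) / \<sigma>\<^sup>2)) * indicator A z \<partial>gauss \<sigma>)"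
proof -
  have "(\<lambda>z. x + z) -` A \<in> sets borel"
    using measurable_sets_borel[of "\<lambda>z. x + z" borel A] by simp
  then have "emeasure (gauss \<sigma>) ((\<lambda>z. x + z) -` A) =
      (\<integral>\<^sup>+z. ennreal (normal_density 0 \<sigma> z) * indicator A (x + z) \<partial>lborel)"
    unfolding gauss_def
    by (subst emeasure_density) (auto intro!: nn_integral_cong simp: indicator_def)
  also have "\<dots> = (\<integral>\<^sup>+z. ennreal (normal_density x \<sigma> z) * indicator A z \<partial>lborel)"
    by (subst nn_integral_real_affine[where t=x and c=1])
       (auto simp: normal_density_def)
  also have "\<dots> = (\<integral>\<^sup>+z. ennreal (normal_density 0 \<sigma> z) *
      (ennreal (exp ((x * z - x\<^sup>2 / 2) / \<sigma>\<^sup>2)) * indicator A z) \<partial>lborel)"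
    by (subst normal_density_shift[symmetric]) (simp add: ennreal_mult mult.assoc)
  also have "\<dots> = (\<integral>\<^sup>+z. ennreal (exp ((x * z - x\<^sup>2 / 2) / \<sigma>\<^sup>2)) * indicator A z \<partial>gauss \<sigma>)"
    unfolding gauss_def by (subst nn_integral_density) auto
  finally show ?thesis .
qed

text \<open>Both sides equal the product of the single-letter laws \<open>?N\<close>: a product
  measure is determined by its values on boxes, where each side factors into one-dimensional
  integrals.\<close>

lemma awgn_density: "awgn \<sigma> n x = density (noise \<sigma> n) (\<lambda>z. ennreal (lr \<sigma> n x z))"
proof -
  let ?N = "\<lambda>i. density (gauss \<sigma>) (\<lambda>z. ennreal (exp ((x i * z - (x i)\<^sup>2 / 2) / \<sigma>\<^sup>2)))"
  interpret G: product_sigma_finite "\<lambda>i. gauss \<sigma>" by (rule product_sigma_finite_gauss)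
  have "prob_space (?N i)" for i
    using emeasure_gauss_shift[of UNIV "x i"] prob_space.emeasure_space_1[OF prob_space_gauss]
    by (intro prob_spaceI) (simp add: emeasure_density)
  then interpret N: product_sigma_finite ?N
    unfolding product_sigma_finite_def using prob_space_imp_sigma_finite by blast
  have "awgn \<sigma> n x = PiM {..<n} ?N"
  proof (rule N.PiM_eqI)
    show "sets (awgn \<sigma> n x) = sets (PiM {..<n} ?N)"
      unfolding awgn_def euclid_def by (auto intro!: sets_PiM_cong)
    fix A assume A: "\<And>i. i \<in> {..<n} \<Longrightarrow> A i \<in> sets (?N i)"
    then have A': "\<And>i. i < n \<Longrightarrow> A i \<in> sets borel" by auto
    have "emeasure (awgn \<sigma> n x) (Pi\<^sub>E {..<n} A) =
       emeasure (noise \<sigma> n) (vec_add n x -` Pi\<^sub>E {..<n} A \<inter> space (noise \<sigma> n))"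
      unfolding awgn_def using A'
      by (subst emeasure_distr) (auto simp: euclid_def intro!: sets_PiM_I_finite)
    also have "vec_add n x -` Pi\<^sub>E {..<n} A \<inter> space (noise \<sigma> n) =
        (\<Pi>\<^sub>E i\<in>{..<n}. (\<lambda>z. x i + z) -` A i)"
      by (auto simp: vec_add_def space_noise space_euclid PiE_iff)
    also have "emeasure (noise \<sigma> n) \<dots> = (\<Prod>i<n. emeasure (gauss \<sigma>) ((\<lambda>z. x i + z) -` A i))"
      unfolding noise_eq using A'
      by (subst G.emeasure_PiM) (auto intro!: measurable_sets_borel[of _ borel])
    also have "\<dots> = (\<Prod>i<n. emeasure (?N i) (A i))"
      using A' by (intro prod.cong) (auto simp: emeasure_gauss_shift emeasure_density)
    finally show "emeasure (awgn \<sigma> n x) (Pi\<^sub>E {..<n} A) = (\<Prod>i\<in>{..<n}. emeasure (?N i) (A i))" .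
  qed simp
  moreover have "density (noise \<sigma> n) (\<lambda>z. ennreal (lr \<sigma> n x z)) = PiM {..<n} ?N"
  proof (rule N.PiM_eqI)
    show "sets (density (noise \<sigma> n) (\<lambda>z. ennreal (lr \<sigma> n x z))) = sets (PiM {..<n} ?N)"
      unfolding noise_eq by (auto intro!: sets_PiM_cong)
    fix A assume A: "\<And>i. i \<in> {..<n} \<Longrightarrow> A i \<in> sets (?N i)"
    then have A': "\<And>i. i < n \<Longrightarrow> A i \<in> sets borel" by auto
    have PA: "Pi\<^sub>E {..<n} A \<in> sets (noise \<sigma> n)"
      unfolding noise_eq using A by (intro sets_PiM_I_finite) auto
    have "emeasure (density (noise \<sigma> n) (\<lambda>z. ennreal (lr \<sigma> n x z))) (Pi\<^sub>E {..<n} A) =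
      (\<integral>\<^sup>+z. ennreal (lr \<sigma> n x z) * indicator (Pi\<^sub>E {..<n} A) z \<partial>noise \<sigma> n)"
      using PA by (subst emeasure_density) auto
    also have "\<dots> = (\<integral>\<^sup>+z. (\<Prod>i<n. ennreal (exp ((x i * z i - (x i)\<^sup>2 / 2) / \<sigma>\<^sup>2)) * indicator (A i) (z i)) \<partial>noise \<sigma> n)"
    proof (rule nn_integral_cong)
      fix z assume "z \<in> space (noise \<sigma> n)"
      then have "indicator (Pi\<^sub>E {..<n} A) z = (\<Prod>i<n. indicator (A i) (z i) :: ennreal)"
        by (auto simp: space_noise space_euclid PiE_iff indicator_def prod_zero_iff)
      then show "ennreal (lr \<sigma> n x z) * indicator (Pi\<^sub>E {..<n} A) z =
         (\<Prod>i<n. ennreal (exp ((x i * z i - (x i)\<^sup>2 / 2) / \<sigma>\<^sup>2)) * indicator (A i) (z i))"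
        by (simp add: lr_def prod_ennreal prod.distrib)
    qed
    also have "\<dots> = (\<Prod>i<n. \<integral>\<^sup>+z. ennreal (exp ((x i * z - (x i)\<^sup>2 / 2) / \<sigma>\<^sup>2)) * indicator (A i) z \<partial>gauss \<sigma>)"
      unfolding noise_eq using A'
      by (subst G.product_nn_integral_prod[symmetric]) auto
    also have "\<dots> = (\<Prod>i<n. emeasure (?N i) (A i))"
      using A' by (intro prod.cong) (auto simp: emeasure_density)
    finally show "emeasure (density (noise \<sigma> n) (\<lambda>z. ennreal (lr \<sigma> n x z))) (Pi\<^sub>E {..<n} A) =
       (\<Prod>i\<in>{..<n}. emeasure (?N i) (A i))" .
  qed simp
  ultimately show ?thesis by simp
qed

end

section \<open>Mixtures and their divergence\<close>

text \<open>The density of \<open>output_dist\<close> with respect to \<open>noise\<close>. The key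
  type is polymorphic so that pairs of a codebook and a flag can serve as keys before
  \<open>is_codeI\<close> relabels them by numbers.\<close>

definition mixture ::
  "real \<Rightarrow> nat \<Rightarrow> nat set \<Rightarrow> 'k set \<Rightarrow> (nat \<times> 'k \<Rightarrow> nat \<Rightarrow> real) \<Rightarrow> (nat \<Rightarrow> real) \<Rightarrow> real" where
  "mixture \<sigma> n W K f z =
     1 / (real (card K) * real (card W)) * (\<Sum>k\<in>K. \<Sum>w\<in>W. lr \<sigma> n (f (w, k)) z)"

lemma mixture_measurable [measurable]:
  "mixture \<sigma> n W K f \<in> borel_measurable (\<Pi>\<^sub>M i\<in>{..<n}. borel)"
  unfolding mixture_def[abs_def] by measurable

lemma mixture_nonneg: "0 \<le> mixture \<sigma> n W K f z"
  unfolding mixture_def by (intro mult_nonneg_nonneg sum_nonneg) auto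

section \<open>Inequalities for x ln x and a uniform bound on likelihood ratios\<close>

lemma xlnx_upper: "h * ln h \<le> h\<^sup>2" if "0 \<le> h" for h :: real
proof (cases "h = 0")
  case False
  with that have "ln h \<le> h - 1" by (intro ln_le_minus_one) auto
  then have "h * ln h \<le> h * h" using that by (intro mult_left_mono) auto
  then show ?thesis by (simp add: power2_eq_square)
qed auto

text \<open>Young's inequality for the convex function h ln h - h and its conjugate exp, obtained
  from exp x >= 1 + x. It serves both to compare two measures and as a tangent-line form of the
  convexity of x ln x.\<close>

lemma xlnx_young: "h * c \<le> h * ln h - h + exp c" if "0 \<le> h" for h c :: real
proof (cases "h = 0")
  case False
  with that have "0 < h" by simp
  have "1 + (c - ln h) \<le> exp (c - ln h)" by (rule exp_ge_add_one_self)
  then have "h * (1 + (c - ln h)) \<le> h * exp (c - ln h)"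
    using \<open>0 < h\<close> by (intro mult_left_mono) auto
  also have "h * exp (c - ln h) = exp c"
    using \<open>0 < h\<close> by (simp add: exp_diff)
  finally show ?thesis by (simp add: algebra_simps)
qed auto

lemma xlnx_lower: "- 1 \<le> h * ln h" if "0 \<le> h" for h :: real
  using xlnx_young[OF that, of 0] that by simp

text \<open>Maximised over x_i, the exponent of a letter is y_i^2 / (2 \<sigma>^2). The resulting
  uniformity in the codeword is what makes the number of messages finite.\<close>

lemma lr_le_exp:
  assumes "0 < \<sigma>" "(\<Sum>i<n. (y i)\<^sup>2) \<le> R"
  shows "lr \<sigma> n x y \<le> exp (R / (2 * \<sigma>\<^sup>2))"
proof -
  have "(x i * y i - (x i)\<^sup>2 / 2) / \<sigma>\<^sup>2 \<le> ((y i)\<^sup>2 / 2) / \<sigma>\<^sup>2" for i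
  proof (rule divide_right_mono)
    have "0 \<le> (x i - y i)\<^sup>2" by simp
    then show "x i * y i - (x i)\<^sup>2 / 2 \<le> (y i)\<^sup>2 / 2" by (simp add: power2_diff)
  qed simp
  then have "(\<Sum>i<n. (x i * y i - (x i)\<^sup>2 / 2) / \<sigma>\<^sup>2) \<le> (\<Sum>i<n. ((y i)\<^sup>2 / 2) / \<sigma>\<^sup>2)"
    by (rule sum_mono)
  also have "\<dots> = (\<Sum>i<n. (y i)\<^sup>2) / (2 * \<sigma>\<^sup>2)"
    by (simp add: sum_divide_distrib)
  also have "\<dots> \<le> R / (2 * \<sigma>\<^sup>2)"
    using assms by (intro divide_right_mono) auto
  finally show ?thesis by (simp add: lr_eq_exp)
qed

section \<open>The output law as a density and its divergence from noise\<close>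

context
  fixes \<sigma> :: real
  assumes \<sigma>_pos: "0 < \<sigma>"
begin

lemma output_dist_density:
  "output_dist \<sigma> n W K f = density (noise \<sigma> n) (\<lambda>z. ennreal (mixture \<sigma> n W K f z))"
  (is "_ = ?D")
proof -
  define c where "c = 1 / (real (card K) * real (card W))"
  have [simp]: "0 \<le> c" by (simp add: c_def)
  have mix: "mixture \<sigma> n W K f z = c * (\<Sum>k\<in>K. \<Sum>w\<in>W. lr \<sigma> n (f (w, k)) z)" for z
    by (simp only: mixture_def c_def)
  have eq: "ennreal c * (\<Sum>k\<in>K. \<Sum>w\<in>W. emeasure (awgn \<sigma> n (f (w, k))) A) = emeasure ?D A"
    if "A \<in> sets (euclid n)" for A
  proof -
    have [measurable]: "A \<in> sets (noise \<sigma> n)" using that by (simp add: sets_noise)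
    have "emeasure ?D A = (\<integral>\<^sup>+z. ennreal (mixture \<sigma> n W K f z) * indicator A z \<partial>noise \<sigma> n)"
      by (subst emeasure_density) auto
    also have "\<dots> = (\<integral>\<^sup>+z. ennreal c * (\<Sum>k\<in>K. \<Sum>w\<in>W. ennreal (lr \<sigma> n (f (w, k)) z) * indicator A z) \<partial>noise \<sigma> n)"
      unfolding mix
      by (intro nn_integral_cong)
         (simp add: ennreal_mult sum_nonneg sum_ennreal[symmetric] sum_distrib_right mult.assoc del: sum_ennreal)
    also have "\<dots> = ennreal c * (\<Sum>k\<in>K. \<Sum>w\<in>W. \<integral>\<^sup>+z. ennreal (lr \<sigma> n (f (w, k)) z) * indicator A z \<partial>noise \<sigma> n)"
      by (subst nn_integral_cmult, measurable) (simp add: nn_integral_sum)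
    also have "\<dots> = ennreal c * (\<Sum>k\<in>K. \<Sum>w\<in>W. emeasure (awgn \<sigma> n (f (w, k))) A)"
      by (simp add: awgn_density[OF \<sigma>_pos] emeasure_density)
    finally show ?thesis by simp
  qed
  \<comment> \<open>The set function given to \<open>measure_of\<close> agrees on measurable sets
    with a genuine measure, so \<open>measure_of\<close> returns that measure and not a
    default.\<close>
  have "output_dist \<sigma> n W K f = measure_of (space (euclid n)) (sets (euclid n)) (emeasure ?D)"
    unfolding output_dist_def c_def[symmetric]
    by (rule measure_of_eq) (auto simp: sets.space_closed sets.sigma_sets_eq eq)
  also have "\<dots> = measure_of (space ?D) (sets ?D) (emeasure ?D)"
    by (simp add: sets_noise space_noise)
  also have "\<dots> = ?D" by (rule measure_of_of_measure)
  finally show ?thesis .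
qed

lemma KL_output_dist:
  "KL_divergence (exp 1) (noise \<sigma> n) (output_dist \<sigma> n W K f) =
     (\<integral>z. mixture \<sigma> n W K f z * ln (mixture \<sigma> n W K f z) \<partial>noise \<sigma> n)"
proof -
  interpret prob_space "noise \<sigma> n" by (rule prob_space_noise[OF \<sigma>_pos])
  show ?thesis
    unfolding output_dist_density
    by (subst KL_density) (auto simp: mixture_nonneg log_ln[symmetric])
qed

lemma lr_square_integrable:
  "integrable (noise \<sigma> n) (\<lambda>z. lr \<sigma> n x z * lr \<sigma> n x' z)"
  using lr_mult_integral[OF \<sigma>_pos, of n x x'] by (auto simp: has_bochner_integral_iff)

lemma lr_integrable: "integrable (noise \<sigma> n) (lr \<sigma> n x)"
  using lr_integral[OF \<sigma>_pos, of n x] by (auto simp: has_bochner_integral_iff)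

lemma mixture_integrable: "integrable (noise \<sigma> n) (mixture \<sigma> n W K f)"
  unfolding mixture_def[abs_def] using lr_integrable by (auto intro!: integrable_sum)

lemma mixture_integral:
  assumes "finite W" "W \<noteq> {}" "finite K" "K \<noteq> {}"
  shows "(\<integral>z. mixture \<sigma> n W K f z \<partial>noise \<sigma> n) = 1"
proof -
  have "(\<integral>z. lr \<sigma> n x z \<partial>noise \<sigma> n) = 1" for x
    using lr_integral[OF \<sigma>_pos, of n x] by (auto simp: has_bochner_integral_iff)
  then show ?thesis
    unfolding mixture_def[abs_def] using lr_integrable assms
    by (simp add: Bochner_Integration.integral_sum card_eq_0_iff)
qed

lemma mixture_square_integrable: "integrable (noise \<sigma> n) (\<lambda>z. (mixture \<sigma> n W K f z)\<^sup>2)"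
proof -
  have "(mixture \<sigma> n W K f z)\<^sup>2 = (1 / (real (card K) * real (card W)))\<^sup>2 *
      (\<Sum>k\<in>K. \<Sum>k'\<in>K. \<Sum>w\<in>W. \<Sum>w'\<in>W. lr \<sigma> n (f (w, k)) z * lr \<sigma> n (f (w', k')) z)" for z
    unfolding mixture_def power_mult_distrib
    by (simp only: power2_eq_square sum_product)
  then show ?thesis
    by (simp only:) (intro integrable_mult_right Bochner_Integration.integrable_sum lr_square_integrable)
qed

text \<open>As h ln h lies between -1 and h^2, square integrability dominates it. Hence the Bochner
  integral in the divergence of a mixture is a true value and not the default 0.\<close>

lemma integrable_xlnx:
  fixes h :: "(nat \<Rightarrow> real) \<Rightarrow> real"
  assumes [measurable]: "h \<in> borel_measurable (noise \<sigma> n)"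
    and nn: "\<And>z. 0 \<le> h z" and "integrable (noise \<sigma> n) (\<lambda>z. (h z)\<^sup>2)"
  shows "integrable (noise \<sigma> n) (\<lambda>z. h z * ln (h z))"
proof (rule Bochner_Integration.integrable_bound)
  interpret prob_space "noise \<sigma> n" by (rule prob_space_noise[OF \<sigma>_pos])
  show "integrable (noise \<sigma> n) (\<lambda>z. 1 + (h z)\<^sup>2)"
    using assms by auto
  have "\<bar>h z * ln (h z)\<bar> \<le> 1 + (h z)\<^sup>2" for z
    using xlnx_upper[OF nn] xlnx_lower[OF nn] by (smt (verit) zero_le_power2)
  then show "AE z in noise \<sigma> n. norm (h z * ln (h z)) \<le> norm (1 + (h z)\<^sup>2)"
    by (intro AE_I2) (simp add: abs_of_nonneg)
qed measurable

text \<open>In the manner of the Donsker-Varadhan formula, \<open>xlnx_young\<close> is integrated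
  with exponent \<open>T\<close> on \<open>A\<close> and 0 elsewhere. A large \<open>T\<close> makes
  the contribution of the divergence small; a small noise probability of \<open>A\<close> then
  absorbs exp T.\<close>

lemma mixture_prob_le_KL:
  assumes fin: "finite W" "W \<noteq> {}" "finite K" "K \<noteq> {}"
    and [measurable]: "A \<in> sets (noise \<sigma> n)"
  shows "T * (\<integral>z. mixture \<sigma> n W K f z * indicator A z \<partial>noise \<sigma> n) \<le>
    KL_divergence (exp 1) (noise \<sigma> n) (output_dist \<sigma> n W K f) + exp T * measure (noise \<sigma> n) A"
proof -
  interpret prob_space "noise \<sigma> n" by (rule prob_space_noise[OF \<sigma>_pos])
  let ?h = "mixture \<sigma> n W K f"
  have int[simp]: "integrable (noise \<sigma> n) (\<lambda>z. ?h z * ln (?h z))" "integrable (noise \<sigma> n) ?h"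
    by (rule integrable_xlnx, measurable, rule mixture_nonneg, rule mixture_square_integrable)
       (rule mixture_integrable)
  have [simp]: "integrable (noise \<sigma> n) (\<lambda>z. ?h z * indicator A z)"
    by (rule integrable_real_mult_indicator) auto
  have [simp]: "integrable (noise \<sigma> n) (indicat_real A)"
    by (simp add: emeasure_eq_measure)
  have "T * (\<integral>z. ?h z * indicator A z \<partial>noise \<sigma> n) = (\<integral>z. T * (?h z * indicator A z) \<partial>noise \<sigma> n)"
    by simp
  also have "\<dots> \<le> (\<integral>z. (?h z * ln (?h z) - ?h z + 1) + exp T * indicator A z \<partial>noise \<sigma> n)"
  proof (rule integral_mono)
    fix z
    show "T * (?h z * indicator A z) \<le> (?h z * ln (?h z) - ?h z + 1) + exp T * indicator A z"
      using xlnx_young[OF mixture_nonneg[of \<sigma> n W K f z], of "T * indicator A z"]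
      by (auto simp: indicator_def mult.commute split: if_splits)
  qed (intro Bochner_Integration.integrable_add Bochner_Integration.integrable_diff
      integrable_const integrable_mult_right; simp)+
  also have "\<dots> = (\<integral>z. ?h z * ln (?h z) \<partial>noise \<sigma> n) + exp T * measure (noise \<sigma> n) A"
    using mixture_integral[OF fin, of n f] by (simp add: prob_space sets.sets_into_space Int_absorb2)
  finally show ?thesis by (simp add: KL_output_dist)
qed

lemma measure_noise_vec_add:
  assumes A: "A \<in> sets (euclid n)"
  shows "measure (noise \<sigma> n) {z \<in> space (noise \<sigma> n). vec_add n x z \<in> A} =
    (\<integral>z. lr \<sigma> n x z * indicator A z \<partial>noise \<sigma> n)"
proof -
  have [measurable]: "A \<in> sets (noise \<sigma> n)" using A by (simp add: sets_noise)
  have [measurable]: "A \<in> sets (\<Pi>\<^sub>M i\<in>{..<n}. borel)" using A by (simp add: sets_euclid)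
  have "measure (awgn \<sigma> n x) A = measure (noise \<sigma> n) {z \<in> space (noise \<sigma> n). vec_add n x z \<in> A}"
    unfolding awgn_def using A by (subst measure_distr) (auto intro!: arg_cong[of _ _ "measure _"])
  moreover have "emeasure (awgn \<sigma> n x) A = ennreal (\<integral>z. lr \<sigma> n x z * indicator A z \<partial>noise \<sigma> n)"
    unfolding awgn_density[OF \<sigma>_pos]
    by (subst emeasure_density, measurable,
        subst nn_integral_eq_integral[OF integrable_real_mult_indicator[OF _ lr_integrable], symmetric])
       (auto intro!: nn_integral_cong simp: indicator_def)
  then have "measure (awgn \<sigma> n x) A = (\<integral>z. lr \<sigma> n x z * indicator A z \<partial>noise \<sigma> n)"
    by (simp add: measure_def)
  ultimately show ?thesis by simp
qed

lemma noise_tail: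
  assumes "0 < e"
  obtains R where "measure (noise \<sigma> n) {z \<in> space (noise \<sigma> n). R < (\<Sum>i<n. (z i)\<^sup>2)} < e"
proof -
  interpret prob_space "noise \<sigma> n" by (rule prob_space_noise[OF \<sigma>_pos])
  let ?A = "\<lambda>k::nat. {z \<in> space (noise \<sigma> n). real k < (\<Sum>i<n. (z i)\<^sup>2)}"
  have "(\<lambda>k. prob (?A k)) \<longlonglongrightarrow> prob (\<Inter>k. ?A k)"
    by (rule finite_Lim_measure_decseq) (auto simp: decseq_def)
  moreover have "(\<Inter>k. ?A k) = {}"
  proof -
    have "\<exists>k. z \<notin> ?A k" for z
      using reals_Archimedean2[of "\<Sum>i<n. (z i)\<^sup>2"] by (auto dest: less_asym)
    then show ?thesis by blast
  qed
  ultimately have "(\<lambda>k. prob (?A k)) \<longlonglongrightarrow> 0" by simp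
  then have "eventually (\<lambda>k. prob (?A k) < e) sequentially"
    using assms by (rule order_tendstoD(2))
  then show ?thesis
    using that by (auto simp: eventually_sequentially)
qed

end

section \<open>Boundedness of the number of messages\<close>

context
  fixes \<sigma> :: real
  assumes \<sigma>_pos: "0 < \<sigma>"
begin

lemma decoding_set_measurable:
  assumes "code n W K f g" "k \<in> K"
  shows "{y \<in> space (euclid n). P (g (y, k))} \<in> sets (euclid n)"
proof -
  have g: "g \<in> measurable (euclid n \<Otimes>\<^sub>M count_space K) (count_space W)"
    using assms by (simp add: code_def)
  have "(\<lambda>y. (y, k)) \<in> measurable (euclid n) (euclid n \<Otimes>\<^sub>M count_space K)"
    using assms by (intro measurable_Pair measurable_ident measurable_const) auto
  from measurable_compose[OF this g]
  have gk: "(\<lambda>y. g (y, k)) \<in> measurable (euclid n) (count_space W)" .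
  have "{y \<in> space (euclid n). P (g (y, k))} = (\<lambda>y. g (y, k)) -` {w\<in>W. P w} \<inter> space (euclid n)"
    using measurable_space[OF gk] by auto
  also have "\<dots> \<in> sets (euclid n)"
    by (rule measurable_sets[OF gk]) auto
  finally show ?thesis .
qed

text \<open>Outside \<open>A\<close> likelihood ratios are at most \<open>C\<close>, so a message is
  decoded correctly there with probability at most \<open>C\<close> times the noise measure of its
  decoding region. The regions of one key are disjoint, so their noise measures sum to at most one,
  which caps the number of messages.\<close>

lemma card_messages_le:
  assumes code: "code n W K f g"
    and err: "avg_error \<sigma> n W K f g \<le> \<epsilon>"
    and tail: "(\<integral>z. mixture \<sigma> n W K f z * indicator A z \<partial>noise \<sigma> n) \<le> (1 - \<epsilon>) / 2"
    and A: "A \<in> sets (euclid n)"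
    and bound: "\<And>x y. y \<in> space (euclid n) - A \<Longrightarrow> lr \<sigma> n x y \<le> C"
    and "0 \<le> C"
  shows "(1 - \<epsilon>) / 2 * real (card W) \<le> C"
proof -
  interpret prob_space "noise \<sigma> n" by (rule prob_space_noise[OF \<sigma>_pos])
  let ?Q = "noise \<sigma> n"
  have fin: "finite W" "W \<noteq> {}" "finite K" "K \<noteq> {}" using code by (auto simp: code_def)
  define c where "c = 1 / (real (card K) * real (card W))"
  have c: "0 < c" using fin by (simp add: c_def card_gt_0_iff)
  have cKW: "c * (\<Sum>k\<in>K. \<Sum>w\<in>W. 1) = 1" using fin by (simp add: c_def)
  define D where "D w k = {y \<in> space (euclid n). g (y, k) = w}" for w k
  define E where "E w k = {y \<in> space (euclid n). g (y, k) \<noteq> w}" for w k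
  have DM [measurable]: "D w k \<in> sets ?Q" "D w k \<in> sets (euclid n)"
    and EM [measurable]: "E w k \<in> sets ?Q" "E w k \<in> sets (euclid n)" if "k \<in> K" for w k
    using decoding_set_measurable[OF code that] by (simp_all add: D_def E_def sets_noise)
  have AM [measurable]: "A \<in> sets ?Q" using A by (simp add: sets_noise)
  have lr1: "(\<integral>z. lr \<sigma> n x z \<partial>?Q) = 1" for x
    using lr_integral[OF \<sigma>_pos, of n x] by (auto simp: has_bochner_integral_iff)
  have intI: "integrable ?Q (\<lambda>z. lr \<sigma> n x z * indicator B z)" if "B \<in> sets ?Q" for x B
    using that by (rule integrable_real_mult_indicator[OF _ lr_integrable[OF \<sigma>_pos]])
  have err_eq: "avg_error \<sigma> n W K f g =
      c * (\<Sum>k\<in>K. \<Sum>w\<in>W. \<integral>z. lr \<sigma> n (f (w, k)) z * indicator (E w k) z \<partial>?Q)"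
    unfolding avg_error_def c_def
  proof (intro arg_cong2[of _ _ _ _ "(*)"] refl sum.cong)
    fix k w assume "k \<in> K"
    have "{z \<in> space ?Q. g (vec_add n (f (w, k)) z, k) \<noteq> w} =
        {z \<in> space ?Q. vec_add n (f (w, k)) z \<in> E w k}"
      by (auto simp: E_def vec_add_def space_euclid)
    then show "measure ?Q {z \<in> space ?Q. g (vec_add n (f (w, k)) z, k) \<noteq> w} =
        (\<integral>z. lr \<sigma> n (f (w, k)) z * indicator (E w k) z \<partial>?Q)"
      using measure_noise_vec_add[OF \<sigma>_pos EM(2)[OF \<open>k \<in> K\<close>]] by simp
  qed
  \<comment> \<open>Every output is misdecoded, or lies in \<open>A\<close>, or lies in
    \<open>D w k\<close> outside \<open>A\<close>, where the density is at most
    \<open>C\<close>.\<close>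
  have split: "1 \<le> (\<integral>z. lr \<sigma> n (f (w, k)) z * indicator (E w k) z \<partial>?Q) +
      (\<integral>z. lr \<sigma> n (f (w, k)) z * indicator A z \<partial>?Q) + C * measure ?Q (D w k)" if "k \<in> K" for k w
  proof -
    have "1 = (\<integral>z. lr \<sigma> n (f (w, k)) z \<partial>?Q)" by (simp add: lr1)
    also have "\<dots> \<le> (\<integral>z. lr \<sigma> n (f (w, k)) z * indicator (E w k) z +
        lr \<sigma> n (f (w, k)) z * indicator A z + C * indicator (D w k) z \<partial>?Q)"
    proof (rule integral_mono)
      fix z assume "z \<in> space ?Q"
      then show "lr \<sigma> n (f (w, k)) z \<le> lr \<sigma> n (f (w, k)) z * indicator (E w k) z +
        lr \<sigma> n (f (w, k)) z * indicator A z + C * indicator (D w k) z"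
        using bound[of z "f (w, k)"] \<open>0 \<le> C\<close>
        by (auto simp: indicator_def D_def E_def space_noise)
    next
      show "integrable ?Q (\<lambda>z. lr \<sigma> n (f (w, k)) z * indicator (E w k) z +
        lr \<sigma> n (f (w, k)) z * indicator A z + C * indicator (D w k) z)"
        using that by (intro Bochner_Integration.integrable_add intI) (auto simp: emeasure_eq_measure)
    qed (rule lr_integrable[OF \<sigma>_pos])
    also have "\<dots> = (\<integral>z. lr \<sigma> n (f (w, k)) z * indicator (E w k) z \<partial>?Q) +
      (\<integral>z. lr \<sigma> n (f (w, k)) z * indicator A z \<partial>?Q) + C * measure ?Q (D w k)"
      using intI[OF EM(1)[OF that]] intI[OF AM] DM(1)[OF that]
      by (simp add: emeasure_eq_measure Int_absorb2 sets.sets_into_space)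
    finally show ?thesis .
  qed
  have DQ: "(\<Sum>w\<in>W. measure ?Q (D w k)) \<le> 1" if "k \<in> K" for k
  proof -
    have "(\<Sum>w\<in>W. measure ?Q (D w k)) = prob (\<Union>w\<in>W. D w k)"
      using fin DM(1)[OF that]
      by (intro finite_measure_finite_Union[symmetric]) (auto simp: disjoint_family_on_def D_def)
    then show ?thesis by simp
  qed
  have "1 = c * (\<Sum>k\<in>K. \<Sum>w\<in>W. 1)" by (simp only: cKW)
  also have "\<dots> \<le> c * (\<Sum>k\<in>K. \<Sum>w\<in>W. (\<integral>z. lr \<sigma> n (f (w, k)) z * indicator (E w k) z \<partial>?Q) +
      (\<integral>z. lr \<sigma> n (f (w, k)) z * indicator A z \<partial>?Q) + C * measure ?Q (D w k))"
    using c split by (intro mult_left_mono sum_mono) auto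
  also have "\<dots> = avg_error \<sigma> n W K f g +
      c * (\<Sum>k\<in>K. \<Sum>w\<in>W. (\<integral>z. lr \<sigma> n (f (w, k)) z * indicator A z \<partial>?Q)) +
      c * C * (\<Sum>k\<in>K. \<Sum>w\<in>W. measure ?Q (D w k))"
    unfolding err_eq sum.distrib by (simp add: distrib_left sum_distrib_left mult.assoc)
  also have "c * (\<Sum>k\<in>K. \<Sum>w\<in>W. (\<integral>z. lr \<sigma> n (f (w, k)) z * indicator A z \<partial>?Q)) =
      (\<integral>z. mixture \<sigma> n W K f z * indicator A z \<partial>?Q)"
    unfolding mixture_def c_def[symmetric] mult.assoc sum_distrib_right
    using intI[OF AM] by (simp add: Bochner_Integration.integral_sum)
  also have "c * C * (\<Sum>k\<in>K. \<Sum>w\<in>W. measure ?Q (D w k)) \<le> c * C * (\<Sum>k\<in>K. 1)"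
    using c \<open>0 \<le> C\<close> DQ by (intro mult_left_mono sum_mono) auto
  also have "c * C * (\<Sum>k\<in>K. 1) = C / real (card W)"
    using fin by (simp add: c_def)
  finally have "1 \<le> \<epsilon> + (1 - \<epsilon>) / 2 + C / real (card W)"
    using err tail by linarith
  then have "(1 - \<epsilon>) / 2 \<le> C / real (card W)" by argo
  then show ?thesis using fin by (simp add: pos_le_divide_eq card_gt_0_iff)
qed

text \<open>Gives \<open>Max\<close> in \<open>M_star\<close> its meaning: finiteness lets the
  existence of one code bound \<open>M_star\<close> from below.\<close>

lemma finite_is_code:
  assumes "\<epsilon> < 1" "0 < \<delta>"
  shows "finite {M. is_code \<sigma> n M \<epsilon> \<delta>}"
proof -
  \<comment> \<open>With this \<open>T\<close> the bound 2 \<delta> / T on the output mass of the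
    tail equals (1 - \<epsilon>) / 2, half of the guaranteed success probability.\<close>
  define T where "T = 4 * \<delta> / (1 - \<epsilon>)"
  have T: "0 < T" using assms by (simp add: T_def)
  \<comment> \<open>The radius does not depend on the code; the tail is so rare that exp T times its
    noise probability stays below \<delta>.\<close>
  obtain R where R: "measure (noise \<sigma> n) {z \<in> space (noise \<sigma> n). R < (\<Sum>i<n. (z i)\<^sup>2)} < \<delta> / exp T"
    using noise_tail[OF \<sigma>_pos, of "\<delta> / exp T" n] assms by auto
  define A where "A = {z \<in> space (noise \<sigma> n). R < (\<Sum>i<n. (z i)\<^sup>2)}"
  have A: "A \<in> sets (noise \<sigma> n)" unfolding A_def by measurable
  define C where "C = exp (R / (2 * \<sigma>\<^sup>2))"
  have "M \<le> nat \<lceil>C / ((1 - \<epsilon>) / 2)\<rceil>" if "is_code \<sigma> n M \<epsilon> \<delta>" for M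
  proof -
    obtain W K f g where code: "code n W K f g" and W: "card W = M"
      and err: "avg_error \<sigma> n W K f g \<le> \<epsilon>"
      and KL: "KL_divergence (exp 1) (noise \<sigma> n) (output_dist \<sigma> n W K f) \<le> \<delta>"
      using \<open>is_code \<sigma> n M \<epsilon> \<delta>\<close> unfolding is_code_def by blast
    let ?P = "\<integral>z. mixture \<sigma> n W K f z * indicator A z \<partial>noise \<sigma> n"
    have "T * ?P \<le> KL_divergence (exp 1) (noise \<sigma> n) (output_dist \<sigma> n W K f) + exp T * measure (noise \<sigma> n) A"
      using code A by (intro mixture_prob_le_KL[OF \<sigma>_pos]) (auto simp: code_def)
    also have "\<dots> \<le> \<delta> + \<delta>"
      using KL R by (intro add_mono) (auto simp: A_def field_simps)
    finally have "?P \<le> 2 * \<delta> / T" using T by (simp add: field_simps)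
    also have "\<dots> = (1 - \<epsilon>) / 2" using assms by (simp add: T_def field_simps)
    finally have "(1 - \<epsilon>) / 2 * real (card W) \<le> C"
    proof (rule card_messages_le[OF code err])
      show "A \<in> sets (euclid n)" using A by (simp add: sets_noise)
      show "lr \<sigma> n x y \<le> C" if "y \<in> space (euclid n) - A" for x y
        unfolding C_def using that by (intro lr_le_exp[OF \<sigma>_pos]) (auto simp: A_def space_noise)
      show "0 \<le> C" by (simp add: C_def)
    qed
    then have "real M \<le> C / ((1 - \<epsilon>) / 2)"
      using assms W by (subst pos_le_divide_eq) (auto simp: mult.commute)
    then show ?thesis by linarith
  qed
  then show ?thesis
    by (intro finite_subset[OF _ finite_atMost]) auto
qed

end

section \<open>Divergence of a binary antipodal input\<close>

lemma tanh_le_self: "tanh x \<le> x" if "0 \<le> x" for x :: real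
proof -
  have "(\<lambda>x. x - tanh x) 0 \<le> (\<lambda>x. x - tanh x) x"
  proof (rule DERIV_nonneg_imp_nondecreasing[OF that])
    fix y :: real
    show "\<exists>d. ((\<lambda>x. x - tanh x) has_real_derivative d) (at y) \<and> 0 \<le> d"
      by (rule exI[of _ "(tanh y)\<^sup>2"]) (auto intro!: derivative_eq_intros)
  qed
  then show ?thesis by simp
qed

lemma cosh_le_exp_square: "cosh x \<le> exp (x\<^sup>2 / 2)" for x :: real
proof -
  let ?f = "\<lambda>x. x\<^sup>2 / 2 - ln (cosh x) :: real"
  have "?f 0 \<le> ?f \<bar>x\<bar>"
  proof (rule DERIV_nonneg_imp_nondecreasing[OF abs_ge_zero])
    fix y :: real assume "0 \<le> y" "y \<le> \<bar>x\<bar>"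
    then show "\<exists>d. (?f has_real_derivative d) (at y) \<and> 0 \<le> d"
      using tanh_le_self[of y]
      by (intro exI[of _ "y - tanh y"] conjI)
         (auto intro!: derivative_eq_intros simp: cosh_real_pos tanh_def)
  qed
  then have "ln (cosh x) \<le> x\<^sup>2 / 2" by simp
  then show ?thesis by (simp add: ln_le_cancel_iff[symmetric] cosh_real_pos del: ln_le_cancel_iff)
qed

text \<open>As tanh' = 1 - tanh^2, an upper bound for tanh integrates to a lower bound of the next
  order. The same alternation gives \<open>tanh_le_quintic\<close>, and one more integration gives
  \<open>ln_cosh_le\<close>.\<close>

lemma tanh_ge_cubic: "x - x ^ 3 / 3 \<le> tanh x" if "0 \<le> x" for x :: real
proof -
  have "(\<lambda>x. tanh x - (x - x ^ 3 / 3)) 0 \<le> (\<lambda>x. tanh x - (x - x ^ 3 / 3)) x"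
  proof (rule DERIV_nonneg_imp_nondecreasing[OF that])
    fix y :: real assume "0 \<le> y" "y \<le> x"
    then have "(tanh y)\<^sup>2 \<le> y\<^sup>2" using tanh_le_self[of y] by (intro power_mono) auto
    then show "\<exists>d. ((\<lambda>x. tanh x - (x - x ^ 3 / 3)) has_real_derivative d) (at y) \<and> 0 \<le> d"
      by (intro exI[of _ "y\<^sup>2 - (tanh y)\<^sup>2"] conjI)
         (auto intro!: derivative_eq_intros simp: power2_eq_square)
  qed
  then show ?thesis by simp
qed

lemma tanh_le_quintic: "tanh x \<le> x - x ^ 3 / 3 + 2 * x ^ 5 / 15" if "0 \<le> x" for x :: real
proof -
  let ?f = "\<lambda>x. x - x ^ 3 / 3 + 2 * x ^ 5 / 15 - tanh x :: real"
  have "?f 0 \<le> ?f x"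
  proof (rule DERIV_nonneg_imp_nondecreasing[OF that])
    fix y :: real assume "0 \<le> y" "y \<le> x"
    have "y\<^sup>2 - 2 * y ^ 4 / 3 \<le> (tanh y)\<^sup>2"
    \<comment> \<open>The cubic lower bound may be squared only where it is nonnegative; where it is
      negative, y^2 <= y^4 / 3 already makes the left side nonpositive.\<close>
    proof (cases "0 \<le> y - y ^ 3 / 3")
      case True
      have "y\<^sup>2 - 2 * y ^ 4 / 3 \<le> (y - y ^ 3 / 3)\<^sup>2"
      proof -
        have "(y - y ^ 3 / 3)\<^sup>2 = y\<^sup>2 - 2 * y ^ 4 / 3 + (y ^ 3)\<^sup>2 / 9"
          by (simp add: power2_eq_square algebra_simps power3_eq_cube power4_eq_xxxx)
        then show ?thesis by simp
      qed
      also have "\<dots> \<le> (tanh y)\<^sup>2"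
        using True tanh_ge_cubic[OF \<open>0 \<le> y\<close>] by (intro power_mono) auto
      finally show ?thesis .
    next
      case False
      have "y * (y - y ^ 3 / 3) \<le> 0" using False \<open>0 \<le> y\<close> by (simp add: mult_nonneg_nonpos)
      then have "y\<^sup>2 - y ^ 4 / 3 \<le> 0"
        by (simp add: power2_eq_square algebra_simps power3_eq_cube power4_eq_xxxx)
      moreover have "0 \<le> y ^ 4" by simp
      moreover have "0 \<le> (tanh y)\<^sup>2" by simp
      ultimately show ?thesis by linarith
    qed
    then show "\<exists>d. (?f has_real_derivative d) (at y) \<and> 0 \<le> d"
      by (intro exI[of _ "(tanh y)\<^sup>2 - (y\<^sup>2 - 2 * y ^ 4 / 3)"] conjI)
         (auto intro!: derivative_eq_intros)
  qed
  then show ?thesis by simp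
qed

text \<open>Integrates the quintic bound on tanh, using evenness. The quartic term matters: x^2 / 2
  alone would give v^4 / 2 per letter at leading order instead of v^4 / 4. The sextic term keeps the
  truncation an upper bound.\<close>

lemma ln_cosh_le: "ln (cosh x) \<le> x\<^sup>2 / 2 - x ^ 4 / 12 + x ^ 6 / 45" for x :: real
proof -
  let ?f = "\<lambda>x. x\<^sup>2 / 2 - x ^ 4 / 12 + x ^ 6 / 45 - ln (cosh x) :: real"
  have "?f 0 \<le> ?f \<bar>x\<bar>"
  proof (rule DERIV_nonneg_imp_nondecreasing[OF abs_ge_zero])
    fix y :: real assume "0 \<le> y" "y \<le> \<bar>x\<bar>"
    then show "\<exists>d. (?f has_real_derivative d) (at y) \<and> 0 \<le> d"
      using tanh_le_quintic[of y]
      by (intro exI[of _ "y - y ^ 3 / 3 + 2 * y ^ 5 / 15 - tanh y"] conjI)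
         (auto intro!: derivative_eq_intros simp: cosh_real_pos tanh_def)
  qed
  then show ?thesis by simp
qed

section \<open>Likelihood ratio and divergence of one antipodal letter\<close>

definition lncosh_poly :: "real \<Rightarrow> real" where
  "lncosh_poly x = x\<^sup>2 / 2 - x ^ 4 / 12 + x ^ 6 / 45"

text \<open>Likelihood ratio of one letter for the equiprobable inputs v \<sigma> and - v \<sigma>,
  with \<open>v\<close> the amplitude in units of the noise deviation. The exponentials keep the
  shape of the factors of \<open>lr\<close>, so that averages over codebooks reduce to it.\<close>

definition bpsk :: "real \<Rightarrow> real \<Rightarrow> real \<Rightarrow> real" where
  "bpsk \<sigma> v z = (exp ((v * \<sigma> * z - (v * \<sigma>)\<^sup>2 / 2) / \<sigma>\<^sup>2) +
     exp ((- (v * \<sigma>) * z - (- (v * \<sigma>))\<^sup>2 / 2) / \<sigma>\<^sup>2)) / 2"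

context
  fixes \<sigma> :: real
  assumes \<sigma>_pos: "0 < \<sigma>"
begin

lemma bpsk_eq: "bpsk \<sigma> v z = exp (- v\<^sup>2 / 2) * cosh (v * z / \<sigma>)"
proof -
  have "(v * \<sigma> * z - (v * \<sigma>)\<^sup>2 / 2) / \<sigma>\<^sup>2 = - v\<^sup>2 / 2 + v * z / \<sigma>"
    "(- (v * \<sigma>) * z - (- (v * \<sigma>))\<^sup>2 / 2) / \<sigma>\<^sup>2 = - v\<^sup>2 / 2 + - (v * z / \<sigma>)"
    using \<sigma>_pos by (simp_all add: field_simps power2_eq_square)
  then show ?thesis
    by (simp only: bpsk_def exp_add cosh_field_def) (simp add: algebra_simps)
qed

lemma bpsk_pos: "0 < bpsk \<sigma> v z"
  by (simp add: bpsk_eq cosh_real_pos)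

lemma ln_bpsk_le: "ln (bpsk \<sigma> v z) \<le> - v\<^sup>2 / 2 + lncosh_poly (v * z / \<sigma>)"
  using ln_cosh_le[of "v * z / \<sigma>"]
  by (simp add: bpsk_eq ln_mult cosh_real_pos lncosh_poly_def)

lemma shifted_moments:
  shows "has_bochner_integral lborel (\<lambda>z. normal_density \<mu> \<sigma> z * z ^ 2) (\<sigma>\<^sup>2 + \<mu>\<^sup>2)"
    and "has_bochner_integral lborel (\<lambda>z. normal_density \<mu> \<sigma> z * z ^ 4)
      (3 * \<sigma> ^ 4 + 6 * \<sigma>\<^sup>2 * \<mu>\<^sup>2 + \<mu> ^ 4)"
    and "has_bochner_integral lborel (\<lambda>z. normal_density \<mu> \<sigma> z * z ^ 6)
      (15 * \<sigma> ^ 6 + 45 * \<sigma> ^ 4 * \<mu>\<^sup>2 + 15 * \<sigma>\<^sup>2 * \<mu> ^ 4 + \<mu> ^ 6)"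
proof -
  let ?N = "normal_density \<mu> \<sigma>"
  note E = normal_moment_even[OF \<sigma>_pos, of \<mu>] and O = normal_moment_odd[OF \<sigma>_pos, of \<mu>]
  have m: "has_bochner_integral lborel (\<lambda>z. ?N z * (z - \<mu>) ^ 0) 1"
    "has_bochner_integral lborel (\<lambda>z. ?N z * (z - \<mu>) ^ 1) 0"
    "has_bochner_integral lborel (\<lambda>z. ?N z * (z - \<mu>) ^ 2) (\<sigma>\<^sup>2)"
    "has_bochner_integral lborel (\<lambda>z. ?N z * (z - \<mu>) ^ 3) 0"
    "has_bochner_integral lborel (\<lambda>z. ?N z * (z - \<mu>) ^ 4) (3 * \<sigma> ^ 4)"
    "has_bochner_integral lborel (\<lambda>z. ?N z * (z - \<mu>) ^ 5) 0"
    "has_bochner_integral lborel (\<lambda>z. ?N z * (z - \<mu>) ^ 6) (15 * \<sigma> ^ 6)"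
    using E[of 0] O[of 0] E[of 1] O[of 1] E[of 2] O[of 2] E[of 3] \<sigma>_pos
    by (simp_all add: fact_numeral power_divide power_mult[symmetric])
  have "has_bochner_integral lborel (\<lambda>z. ?N z * (z - \<mu>) ^ 2 + 2 * \<mu> * (?N z * (z - \<mu>) ^ 1) +
      \<mu>\<^sup>2 * (?N z * (z - \<mu>) ^ 0)) (\<sigma>\<^sup>2 + 2 * \<mu> * 0 + \<mu>\<^sup>2 * 1)"
    by (intro has_bochner_integral_add has_bochner_integral_mult_right m)
  moreover have "?N z * (z - \<mu>) ^ 2 + 2 * \<mu> * (?N z * (z - \<mu>) ^ 1) + \<mu>\<^sup>2 * (?N z * (z - \<mu>) ^ 0) =
      ?N z * z ^ 2" for z
    by algebra
  ultimately show "has_bochner_integral lborel (\<lambda>z. ?N z * z ^ 2) (\<sigma>\<^sup>2 + \<mu>\<^sup>2)"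
    by simp
  have "has_bochner_integral lborel (\<lambda>z. ?N z * (z - \<mu>) ^ 4 + 4 * \<mu> * (?N z * (z - \<mu>) ^ 3) +
      6 * \<mu>\<^sup>2 * (?N z * (z - \<mu>) ^ 2) + 4 * \<mu> ^ 3 * (?N z * (z - \<mu>) ^ 1) +
      \<mu> ^ 4 * (?N z * (z - \<mu>) ^ 0)) (3 * \<sigma> ^ 4 + 4 * \<mu> * 0 + 6 * \<mu>\<^sup>2 * \<sigma>\<^sup>2 + 4 * \<mu> ^ 3 * 0 + \<mu> ^ 4 * 1)"
    by (intro has_bochner_integral_add has_bochner_integral_mult_right m)
  moreover have "?N z * (z - \<mu>) ^ 4 + 4 * \<mu> * (?N z * (z - \<mu>) ^ 3) +
      6 * \<mu>\<^sup>2 * (?N z * (z - \<mu>) ^ 2) + 4 * \<mu> ^ 3 * (?N z * (z - \<mu>) ^ 1) +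
      \<mu> ^ 4 * (?N z * (z - \<mu>) ^ 0) = ?N z * z ^ 4" for z
    by algebra
  ultimately show "has_bochner_integral lborel (\<lambda>z. ?N z * z ^ 4) (3 * \<sigma> ^ 4 + 6 * \<sigma>\<^sup>2 * \<mu>\<^sup>2 + \<mu> ^ 4)"
    by (simp add: mult_ac)
  have "has_bochner_integral lborel (\<lambda>z. ?N z * (z - \<mu>) ^ 6 + 6 * \<mu> * (?N z * (z - \<mu>) ^ 5) +
      15 * \<mu>\<^sup>2 * (?N z * (z - \<mu>) ^ 4) + 20 * \<mu> ^ 3 * (?N z * (z - \<mu>) ^ 3) +
      15 * \<mu> ^ 4 * (?N z * (z - \<mu>) ^ 2) + 6 * \<mu> ^ 5 * (?N z * (z - \<mu>) ^ 1) +
      \<mu> ^ 6 * (?N z * (z - \<mu>) ^ 0))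
      (15 * \<sigma> ^ 6 + 6 * \<mu> * 0 + 15 * \<mu>\<^sup>2 * (3 * \<sigma> ^ 4) + 20 * \<mu> ^ 3 * 0 + 15 * \<mu> ^ 4 * \<sigma>\<^sup>2 + 6 * \<mu> ^ 5 * 0 + \<mu> ^ 6 * 1)"
    by (intro has_bochner_integral_add has_bochner_integral_mult_right m)
  moreover have "?N z * (z - \<mu>) ^ 6 + 6 * \<mu> * (?N z * (z - \<mu>) ^ 5) +
      15 * \<mu>\<^sup>2 * (?N z * (z - \<mu>) ^ 4) + 20 * \<mu> ^ 3 * (?N z * (z - \<mu>) ^ 3) +
      15 * \<mu> ^ 4 * (?N z * (z - \<mu>) ^ 2) + 6 * \<mu> ^ 5 * (?N z * (z - \<mu>) ^ 1) +
      \<mu> ^ 6 * (?N z * (z - \<mu>) ^ 0) = ?N z * z ^ 6" for z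
    by algebra
  ultimately show "has_bochner_integral lborel (\<lambda>z. ?N z * z ^ 6)
      (15 * \<sigma> ^ 6 + 45 * \<sigma> ^ 4 * \<mu>\<^sup>2 + 15 * \<sigma>\<^sup>2 * \<mu> ^ 4 + \<mu> ^ 6)"
    by (simp add: mult_ac)
qed

text \<open>The mean of the sixth-order bound on ln \<open>bpsk\<close> under a normal law of mean v
  \<sigma> or - v \<sigma>, hence an upper bound on the divergence of one letter. The bracketed
  factors are the moments of orders 2, 4 and 6 of the normal law with mean \<open>v\<close> and
  variance 1.\<close>

definition bpsk_div :: "real \<Rightarrow> real" where
  "bpsk_div v = - v\<^sup>2 / 2 + v\<^sup>2 / 2 * (1 + v\<^sup>2) - v ^ 4 / 12 * (3 + 6 * v\<^sup>2 + v ^ 4) +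
     v ^ 6 / 45 * (15 + 45 * v\<^sup>2 + 15 * v ^ 4 + v ^ 6)"

lemma shifted_poly_integral:
  assumes "\<mu>\<^sup>2 = (v * \<sigma>)\<^sup>2"
  shows "has_bochner_integral (gauss \<sigma>)
    (\<lambda>z. exp ((\<mu> * z - \<mu>\<^sup>2 / 2) / \<sigma>\<^sup>2) * (- v\<^sup>2 / 2 + lncosh_poly (v * z / \<sigma>))) (bpsk_div v)"
proof (rule has_bochner_integral_gauss[OF \<sigma>_pos])
  let ?N = "normal_density \<mu> \<sigma>"
  have "has_bochner_integral lborel (\<lambda>z. - v\<^sup>2 / 2 * ?N z + (v / \<sigma>)\<^sup>2 / 2 * (?N z * z ^ 2)
      + (- ((v / \<sigma>) ^ 4) / 12) * (?N z * z ^ 4) + (v / \<sigma>) ^ 6 / 45 * (?N z * z ^ 6))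
    (- v\<^sup>2 / 2 * 1 + (v / \<sigma>)\<^sup>2 / 2 * (\<sigma>\<^sup>2 + \<mu>\<^sup>2) + (- ((v / \<sigma>) ^ 4) / 12) * (3 * \<sigma> ^ 4 + 6 * \<sigma>\<^sup>2 * \<mu>\<^sup>2 + \<mu> ^ 4)
      + (v / \<sigma>) ^ 6 / 45 * (15 * \<sigma> ^ 6 + 45 * \<sigma> ^ 4 * \<mu>\<^sup>2 + 15 * \<sigma>\<^sup>2 * \<mu> ^ 4 + \<mu> ^ 6))"
    using \<sigma>_pos
    by (intro has_bochner_integral_add has_bochner_integral_mult_right shifted_moments)
       (simp add: has_bochner_integral_iff)
  moreover have "- v\<^sup>2 / 2 * ?N z + (v / \<sigma>)\<^sup>2 / 2 * (?N z * z ^ 2)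
      + (- ((v / \<sigma>) ^ 4) / 12) * (?N z * z ^ 4) + (v / \<sigma>) ^ 6 / 45 * (?N z * z ^ 6) =
      normal_density 0 \<sigma> z * (exp ((\<mu> * z - \<mu>\<^sup>2 / 2) / \<sigma>\<^sup>2) * (- v\<^sup>2 / 2 + lncosh_poly (v * z / \<sigma>)))" for z
    unfolding normal_density_shift[OF \<sigma>_pos, of z \<mu>, symmetric] lncosh_poly_def
    by (simp add: algebra_simps power_mult_distrib power_divide)
  moreover have "- v\<^sup>2 / 2 * 1 + (v / \<sigma>)\<^sup>2 / 2 * (\<sigma>\<^sup>2 + \<mu>\<^sup>2) + (- ((v / \<sigma>) ^ 4) / 12) * (3 * \<sigma> ^ 4 + 6 * \<sigma>\<^sup>2 * \<mu>\<^sup>2 + \<mu> ^ 4)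
      + (v / \<sigma>) ^ 6 / 45 * (15 * \<sigma> ^ 6 + 45 * \<sigma> ^ 4 * \<mu>\<^sup>2 + 15 * \<sigma>\<^sup>2 * \<mu> ^ 4 + \<mu> ^ 6) = bpsk_div v"
  proof -
    have 4: "\<mu> ^ 4 = v ^ 4 * \<sigma> ^ 4" and 6: "\<mu> ^ 6 = v ^ 6 * \<sigma> ^ 6"
      using arg_cong[OF assms, of "\<lambda>x. x ^ 2"] arg_cong[OF assms, of "\<lambda>x. x ^ 3"]
      by (simp_all add: power_mult[symmetric] power_mult_distrib)
    have "(v / \<sigma>)\<^sup>2 * (\<sigma>\<^sup>2 + \<mu>\<^sup>2) = v\<^sup>2 * (1 + v\<^sup>2)"
      "(v / \<sigma>) ^ 4 * (3 * \<sigma> ^ 4 + 6 * \<sigma>\<^sup>2 * \<mu>\<^sup>2 + \<mu> ^ 4) = v ^ 4 * (3 + 6 * v\<^sup>2 + v ^ 4)"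
      "(v / \<sigma>) ^ 6 * (15 * \<sigma> ^ 6 + 45 * \<sigma> ^ 4 * \<mu>\<^sup>2 + 15 * \<sigma>\<^sup>2 * \<mu> ^ 4 + \<mu> ^ 6) =
       v ^ 6 * (15 + 45 * v\<^sup>2 + 15 * v ^ 4 + v ^ 6)"
      unfolding 4 6 assms power_divide power_mult_distrib using \<sigma>_pos
      by (simp_all add: field_simps power2_eq_square eval_nat_numeral)
    then show ?thesis unfolding bpsk_div_def by (simp add: algebra_simps)
  qed
  ultimately show "has_bochner_integral lborel (\<lambda>z. normal_density 0 \<sigma> z *
     (exp ((\<mu> * z - \<mu>\<^sup>2 / 2) / \<sigma>\<^sup>2) * (- v\<^sup>2 / 2 + lncosh_poly (v * z / \<sigma>)))) (bpsk_div v)"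
    by (simp only:)
qed (simp add: lncosh_poly_def)

lemma bpsk_poly_integral:
  "has_bochner_integral (gauss \<sigma>) (\<lambda>z. bpsk \<sigma> v z * (- v\<^sup>2 / 2 + lncosh_poly (v * z / \<sigma>))) (bpsk_div v)"
proof -
  have "has_bochner_integral (gauss \<sigma>) (\<lambda>z. 1 / 2 *
      (exp ((v * \<sigma> * z - (v * \<sigma>)\<^sup>2 / 2) / \<sigma>\<^sup>2) * (- v\<^sup>2 / 2 + lncosh_poly (v * z / \<sigma>)) +
       exp ((- (v * \<sigma>) * z - (- (v * \<sigma>))\<^sup>2 / 2) / \<sigma>\<^sup>2) * (- v\<^sup>2 / 2 + lncosh_poly (v * z / \<sigma>))))
      (1 / 2 * (bpsk_div v + bpsk_div v))"
    by (intro has_bochner_integral_mult_right has_bochner_integral_add shifted_poly_integral) auto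
  moreover have "1 / 2 *
      (exp ((v * \<sigma> * z - (v * \<sigma>)\<^sup>2 / 2) / \<sigma>\<^sup>2) * p +
       exp ((- (v * \<sigma>) * z - (- (v * \<sigma>))\<^sup>2 / 2) / \<sigma>\<^sup>2) * p) = bpsk \<sigma> v z * p" for z p
    unfolding bpsk_def by (simp add: distrib_right)
  ultimately show ?thesis by simp
qed

lemma bpsk_integral: "has_bochner_integral (gauss \<sigma>) (bpsk \<sigma> v) 1"
proof -
  have "has_bochner_integral (gauss \<sigma>) (\<lambda>z. exp ((\<mu> * z - \<mu>\<^sup>2 / 2) / \<sigma>\<^sup>2)) 1" for \<mu>
    using \<sigma>_pos
    by (intro has_bochner_integral_gauss) (simp_all add: normal_density_shift has_bochner_integral_iff)
  from has_bochner_integral_mult_right[OF has_bochner_integral_add[OF this[of "v * \<sigma>"] this[of "- (v * \<sigma>)"]], of "1 / 2"]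
  show ?thesis by (simp add: bpsk_def[abs_def] field_simps)
qed

text \<open>The second-order terms cancel and the fourth-order ones leave 1/2 - 1/4 = 1/4. The rest
  is of order six, since the last bracket is at most 90 for v <= 1.\<close>

lemma bpsk_div_le: "bpsk_div v \<le> v ^ 4 / 4 + 2 * v ^ 6" if "0 \<le> v" "v \<le> 1"
proof -
  have "v\<^sup>2 \<le> 1" "v ^ 4 \<le> 1" "v ^ 6 \<le> 1" "0 \<le> v ^ 6" "0 \<le> v ^ 4"
    using that by (auto intro: power_le_one)
  from this(1-3) have "v ^ 6 / 45 * (15 + 45 * v\<^sup>2 + 15 * v ^ 4 + v ^ 6) \<le> v ^ 6 / 45 * 90"
    using \<open>0 \<le> v ^ 6\<close> by (intro mult_left_mono) auto
  moreover have "v ^ 4 / 12 * 3 \<le> v ^ 4 / 12 * (3 + 6 * v\<^sup>2 + v ^ 4)"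
    using \<open>0 \<le> v ^ 4\<close> by (intro mult_left_mono) auto
  moreover have "v\<^sup>2 / 2 * (1 + v\<^sup>2) = v\<^sup>2 / 2 + v ^ 4 / 2"
    by (simp add: distrib_left power_add[symmetric])
  ultimately show ?thesis unfolding bpsk_div_def by argo
qed

end

section \<open>Random codebooks as keys\<close>

definition codebooks :: "nat \<Rightarrow> nat \<Rightarrow> (nat \<times> nat \<Rightarrow> real) set" where
  "codebooks M n = ({..<M} \<times> {..<n} \<rightarrow>\<^sub>E {-1, 1})"

lemma finite_codebooks [simp]: "finite (codebooks M n)"
  unfolding codebooks_def by (intro finite_PiE) auto

lemma codebooks_nonempty: "codebooks M n \<noteq> {}"
  unfolding codebooks_def by (simp add: PiE_eq_empty_iff)

lemma card_codebooks: "card (codebooks M n) = 2 ^ (M * n)"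
  unfolding codebooks_def by (simp add: card_PiE numeral_2_eq_2)

lemma codebooks_values: "c \<in> codebooks M n \<Longrightarrow> w < M \<Longrightarrow> i < n \<Longrightarrow> c (w, i) = -1 \<or> c (w, i) = 1"
  by (auto simp: codebooks_def PiE_iff)

lemma codebooks_square: "c \<in> codebooks M n \<Longrightarrow> w < M \<Longrightarrow> i < n \<Longrightarrow> c (w, i) * c (w, i) = 1"
  using codebooks_values by fastforce

lemma prod_row:
  fixes G :: "nat \<times> nat \<Rightarrow> real"
  assumes "w < M"
  shows "(\<Prod>p\<in>{..<M} \<times> {..<n}. if fst p = w then G p else 1) = (\<Prod>i<n. G (w, i))"
proof -
  have "(\<Prod>p\<in>{..<M} \<times> {..<n}. if fst p = w then G p else 1) =
      (\<Prod>a<M. \<Prod>i<n. if a = w then G (a, i) else 1)"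
    by (subst prod.cartesian_product) (intro prod.cong, auto)
  also have "\<dots> = (\<Prod>a<M. if a = w then \<Prod>i<n. G (a, i) else 1)"
    by (intro prod.cong) auto
  also have "\<dots> = (\<Prod>i<n. G (w, i))"
    using assms by (simp add: prod.delta)
  finally show ?thesis .
qed

text \<open>Under the uniform law on codebooks the entries are independent fair signs, so the mean
  of a product along a row is a product of two-point means. The product is extended to the whole
  table by factors 1 so that product and sum can be exchanged.\<close>

lemma sum_codebooks_row:
  fixes F :: "nat \<Rightarrow> real \<Rightarrow> real"
  assumes "w < M"
  shows "(\<Sum>c\<in>codebooks M n. \<Prod>i<n. F i (c (w, i))) =
    real (card (codebooks M n)) * (\<Prod>i<n. (F i 1 + F i (-1)) / 2)"
proof -
  have "(\<Sum>c\<in>codebooks M n. \<Prod>i<n. F i (c (w, i))) =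
      (\<Sum>c\<in>codebooks M n. \<Prod>p\<in>{..<M} \<times> {..<n}. if fst p = w then F (snd p) (c p) else 1)"
    by (subst prod_row[OF assms]) simp
  also have "\<dots> = (\<Prod>p\<in>{..<M} \<times> {..<n}. \<Sum>s\<in>{-1, 1}. if fst p = w then F (snd p) s else 1)"
    unfolding codebooks_def by (subst prod_sum_PiE) auto
  also have "\<dots> = (\<Prod>p\<in>{..<M} \<times> {..<n}. 2 * (if fst p = w then (F (snd p) 1 + F (snd p) (-1)) / 2 else 1))"
    by (intro prod.cong) auto
  also have "\<dots> = 2 ^ (M * n) * (\<Prod>i<n. (F i 1 + F i (-1)) / 2)"
    unfolding prod.distrib prod_row[OF assms]
    by simp
  finally show ?thesis by (simp add: card_codebooks)
qed

text \<open>Multiplying row \<open>w'\<close> by row \<open>w\<close> is an involution of the set of codebooks, so the sum over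
  pairs of rows reduces to a sum over a single row.\<close>

lemma sum_codebooks_pair:
  assumes w: "w < M" "w' < M" "w \<noteq> w'"
  shows "(\<Sum>c\<in>codebooks M n. exp (t * (\<Sum>i<n. c (w, i) * c (w', i)))) =
    real (card (codebooks M n)) * cosh t ^ n"
proof -
  define \<phi> where "\<phi> c = (\<lambda>p\<in>{..<M} \<times> {..<n}. if fst p = w' then c p * c (w, snd p) else c p)"
    for c :: "nat \<times> nat \<Rightarrow> real"
  have \<phi>_in: "\<phi> c \<in> codebooks M n" if "c \<in> codebooks M n" for c
    unfolding codebooks_def
  proof (rule PiE_I)
    fix p assume "p \<in> {..<M} \<times> {..<n}"
    then show "\<phi> c p \<in> {-1, 1}"
      using codebooks_values[OF that, of "fst p" "snd p"] codebooks_values[OF that, of w "snd p"] w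
      by (auto simp: \<phi>_def)
  qed (simp add: \<phi>_def)
  have \<phi>_\<phi>: "\<phi> (\<phi> c) = c" if "c \<in> codebooks M n" for c
  proof
    fix p show "\<phi> (\<phi> c) p = c p"
    proof (cases "p \<in> {..<M} \<times> {..<n}")
      case True
      then show ?thesis
        using codebooks_square[OF that, of w "snd p"] w by (auto simp: \<phi>_def)
    next
      case False
      then have "c p = undefined"
        using that unfolding codebooks_def by (rule PiE_arb[rotated])
      then show ?thesis unfolding \<phi>_def restrict_apply if_not_P[OF False] by simp
    qed
  qed
  have "(\<Sum>c\<in>codebooks M n. exp (t * (\<Sum>i<n. c (w, i) * c (w', i)))) =
      (\<Sum>c\<in>codebooks M n. \<Prod>i<n. exp (t * c (w', i)))"
  proof (rule sum.reindex_bij_witness[of _ \<phi> \<phi>])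
    fix c assume c: "c \<in> codebooks M n"
    have "(\<Prod>i<n. exp (t * \<phi> c (w', i))) = (\<Prod>i<n. exp (t * (c (w, i) * c (w', i))))"
      using w by (intro prod.cong) (auto simp: \<phi>_def mult_ac)
    then show "(\<Prod>i<n. exp (t * \<phi> c (w', i))) = exp (t * (\<Sum>i<n. c (w, i) * c (w', i)))"
      by (simp add: exp_sum sum_distrib_left)
  qed (auto simp: \<phi>_in \<phi>_\<phi>)
  also have "\<dots> = real (card (codebooks M n)) * (\<Prod>i<n. (exp (t * 1) + exp (t * -1)) / 2)"
    by (rule sum_codebooks_row[where F="\<lambda>i s. exp (t * s)", OF w(2)])
  finally show ?thesis by (simp add: cosh_field_def)
qed

text \<open>The disjunct \<open>Suc w = M\<close> keeps \<open>LEAST\<close> off the empty predicate and the decision below \<open>M\<close>.\<close>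

definition threshold_decoder ::
  "real \<Rightarrow> nat \<Rightarrow> nat \<Rightarrow> real \<Rightarrow> (nat \<Rightarrow> nat \<Rightarrow> real) \<Rightarrow> (nat \<Rightarrow> real) \<Rightarrow> nat" where
  "threshold_decoder \<sigma> n M \<theta> x y = (LEAST w. Suc w = M \<or> \<theta> < lr \<sigma> n (x w) y)"

lemma threshold_decoder_less: "threshold_decoder \<sigma> n M \<theta> x y < M" if "0 < M"
proof -
  have "threshold_decoder \<sigma> n M \<theta> x y \<le> M - 1"
    unfolding threshold_decoder_def using that by (intro Least_le) auto
  then show ?thesis using that by linarith
qed

text \<open>If the true index passes the threshold but is not chosen, the chosen one is smaller,
  hence not the default M - 1, and so it passes the threshold itself.\<close>

lemma threshold_decoder_error:
  assumes "w < M" "threshold_decoder \<sigma> n M \<theta> x y \<noteq> w" "\<theta> < lr \<sigma> n (x w) y"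
  obtains w' where "w' < M" "w' \<noteq> w" "\<theta> < lr \<sigma> n (x w') y"
proof -
  let ?d = "threshold_decoder \<sigma> n M \<theta> x y"
  have "?d \<le> w" unfolding threshold_decoder_def using assms by (intro Least_le) auto
  moreover have "Suc ?d = M \<or> \<theta> < lr \<sigma> n (x ?d) y"
    unfolding threshold_decoder_def by (rule LeastI[of _ w]) (use assms in auto)
  ultimately show ?thesis using assms that[of ?d] by fastforce
qed

lemma threshold_decoder_measurable:
  assumes "0 < M"
  shows "threshold_decoder \<sigma> n M \<theta> x \<in> measurable (euclid n) (count_space {..<M})"
proof -
  have "threshold_decoder \<sigma> n M \<theta> x \<in> measurable (euclid n) (count_space UNIV)"
    unfolding threshold_decoder_def[abs_def] by measurable
  then show ?thesis
    using threshold_decoder_less[OF assms] by (auto simp: measurable_count_space_eq2_countable)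
qed

section \<open>From keyed codebooks to codes: error and divergence bounds\<close>

context
  fixes \<sigma> :: real
  assumes \<sigma>_pos: "0 < \<sigma>"
begin

text \<open>Any finite set may index the keys: a bijection with an initial segment of the naturals
  transports the code, and both criteria are built from sums over keys, invariant under
  relabelling.\<close>

lemma is_codeI:
  fixes K :: "'k set" and x :: "'k \<Rightarrow> nat \<Rightarrow> nat \<Rightarrow> real" and d :: "'k \<Rightarrow> (nat \<Rightarrow> real) \<Rightarrow> nat"
  assumes K: "finite K" "K \<noteq> {}" and M: "0 < M"
    and x: "\<And>k w. k \<in> K \<Longrightarrow> w < M \<Longrightarrow> x k w \<in> space (euclid n)"
    and d: "\<And>k. k \<in> K \<Longrightarrow> d k \<in> measurable (euclid n) (count_space {..<M})"
    and err: "(\<Sum>k\<in>K. \<Sum>w<M. measure (noise \<sigma> n)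
        {z \<in> space (noise \<sigma> n). d k (vec_add n (x k w) z) \<noteq> w}) \<le> \<epsilon> * (real (card K) * real M)"
    and div: "(\<integral>z. mixture \<sigma> n {..<M} K (\<lambda>(w, k). x k w) z *
        ln (mixture \<sigma> n {..<M} K (\<lambda>(w, k). x k w) z) \<partial>noise \<sigma> n) \<le> \<delta>"
  shows "is_code \<sigma> n M \<epsilon> \<delta>"
proof -
  obtain \<kappa> where \<kappa>: "bij_betw \<kappa> {0..<card K} K"
    using ex_bij_betw_nat_finite[OF K(1)] by blast
  let ?K = "{0..<card K}" and ?f = "\<lambda>(w, k). x (\<kappa> k) w" and ?g = "\<lambda>(y, k). d (\<kappa> k) y"
  have \<kappa>K: "\<kappa> k \<in> K" if "k \<in> ?K" for k using \<kappa> that by (auto simp: bij_betw_def)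
  have re: "(\<Sum>k\<in>?K. F (\<kappa> k)) = (\<Sum>k\<in>K. F k)" for F :: "'k \<Rightarrow> real"
    by (rule sum.reindex_bij_betw[OF \<kappa>])
  have "?g \<in> measurable (euclid n \<Otimes>\<^sub>M count_space ?K) (count_space {..<M})"
  proof -
    have "(\<lambda>(k, y). d (\<kappa> k) y) \<in> measurable (count_space ?K \<Otimes>\<^sub>M euclid n) (count_space {..<M})"
      using d \<kappa>K by (intro measurable_pair_measure_countable1) auto
    from measurable_compose[OF measurable_pair_swap' this] show ?thesis
      by (simp add: case_prod_unfold)
  qed
  then have "code n {..<M} ?K ?f ?g"
    using K M x \<kappa>K by (auto simp: code_def card_gt_0_iff)
  moreover have "avg_error \<sigma> n {..<M} ?K ?f ?g \<le> \<epsilon>"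
  proof -
    have "avg_error \<sigma> n {..<M} ?K ?f ?g = 1 / (real (card K) * real M) *
        (\<Sum>k\<in>K. \<Sum>w<M. measure (noise \<sigma> n) {z \<in> space (noise \<sigma> n). d k (vec_add n (x k w) z) \<noteq> w})"
      unfolding avg_error_def using re[of "\<lambda>k. \<Sum>w<M. measure (noise \<sigma> n)
        {z \<in> space (noise \<sigma> n). d k (vec_add n (x k w) z) \<noteq> w}"] by simp
    also have "\<dots> \<le> 1 / (real (card K) * real M) * (\<epsilon> * (real (card K) * real M))"
      by (intro mult_left_mono err) auto
    also have "\<dots> = \<epsilon>" using K M by (simp add: card_gt_0_iff)
    finally show ?thesis .
  qed
  moreover have "KL_divergence (exp 1) (noise \<sigma> n) (output_dist \<sigma> n {..<M} ?K ?f) \<le> \<delta>"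
  proof -
    have "mixture \<sigma> n {..<M} ?K ?f = mixture \<sigma> n {..<M} K (\<lambda>(w, k). x k w)"
      unfolding mixture_def[abs_def]
      using re[of "\<lambda>k. \<Sum>w<M. lr \<sigma> n (x k w) z" for z] by simp
    then show ?thesis using div by (simp add: KL_output_dist[OF \<sigma>_pos])
  qed
  ultimately show ?thesis
    unfolding is_code_def by (intro exI[of _ "{..<M}"] exI[of _ ?K] exI[of _ ?f] exI[of _ ?g]) auto
qed

text \<open>Either the true likelihood ratio misses the threshold, a Chernoff event with parameter
  \<open>s\<close>, or another codeword passes it, a Markov event. Both are bounded pointwise by
  functions whose integrals against the noise law are explicit.\<close>

lemma threshold_decoder_error_prob:
  assumes M: "w < M" and \<theta>: "0 < \<theta>" and s: "0 \<le> s"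
  shows "measure (noise \<sigma> n)
      {z \<in> space (noise \<sigma> n). threshold_decoder \<sigma> n M \<theta> x (vec_add n (x w) z) \<noteq> w} \<le>
    \<theta> powr s * exp (- s * (1 - s) * (\<Sum>i<n. (x w i)\<^sup>2) / (2 * \<sigma>\<^sup>2)) +
    (\<Sum>w'\<in>{..<M} - {w}. exp ((\<Sum>i<n. x w i * x w' i) / \<sigma>\<^sup>2) / \<theta>)"
proof -
  let ?Q = "noise \<sigma> n" and ?d = "threshold_decoder \<sigma> n M \<theta> x"
  define A where "A = {y \<in> space (euclid n). ?d y \<noteq> w}"
  have "A = ?d -` ({..<M} - {w}) \<inter> space (euclid n)"
    using threshold_decoder_less M by (auto simp: A_def)
  then have A: "A \<in> sets (euclid n)"
    using measurable_sets[OF threshold_decoder_measurable[of M \<sigma> n \<theta> x]] M by auto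
  have "{z \<in> space ?Q. ?d (vec_add n (x w) z) \<noteq> w} = {z \<in> space ?Q. vec_add n (x w) z \<in> A}"
    by (auto simp: A_def vec_add_def space_euclid)
  then have "measure ?Q {z \<in> space ?Q. ?d (vec_add n (x w) z) \<noteq> w} =
      (\<integral>z. lr \<sigma> n (x w) z * indicator A z \<partial>?Q)"
    using measure_noise_vec_add[OF \<sigma>_pos A] by simp
  also have "\<dots> \<le> (\<integral>z. \<theta> powr s * lr \<sigma> n (x w) z powr (1 - s) +
      (\<Sum>w'\<in>{..<M} - {w}. 1 / \<theta> * (lr \<sigma> n (x w) z * lr \<sigma> n (x w') z)) \<partial>?Q)" (is "_ \<le> integral\<^sup>L _ ?B")
  proof (rule integral_mono)
    show "integrable ?Q (\<lambda>z. lr \<sigma> n (x w) z * indicator A z)"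
      using A by (intro integrable_real_mult_indicator lr_integrable[OF \<sigma>_pos]) (simp add: sets_noise)
    show "integrable ?Q ?B"
      using lr_powr_integral[OF \<sigma>_pos, of n "x w" "1 - s"]
      by (intro Bochner_Integration.integrable_add Bochner_Integration.integrable_sum
          integrable_mult_right lr_square_integrable[OF \<sigma>_pos]) (auto simp: has_bochner_integral_iff)
    fix z assume "z \<in> space ?Q"
    let ?l = "lr \<sigma> n (x w) z"
    let ?S = "\<Sum>w'\<in>{..<M} - {w}. 1 / \<theta> * (?l * lr \<sigma> n (x w') z)"
    have S: "0 \<le> ?S" using \<theta> by (intro sum_nonneg mult_nonneg_nonneg) auto
    have l: "0 < ?l" by (rule lr_pos)
    consider "z \<notin> A" | "?l \<le> \<theta>" | "z \<in> A" "\<theta> < ?l" by linarith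
    then show "?l * indicator A z \<le> ?B z"
    proof cases
      case 1
      then show ?thesis using S by simp
    next
      case 2
      have "?l * indicator A z \<le> ?l" by (simp add: indicator_def)
      \<comment> \<open>Chernoff step: the split-off power \<open>s\<close> is at most \<theta> powr
        s.\<close>
      also have "?l = ?l powr s * ?l powr (1 - s)" using l by (simp add: powr_add[symmetric])
      also have "\<dots> \<le> \<theta> powr s * ?l powr (1 - s)"
        using 2 s l by (intro mult_right_mono powr_mono2) auto
      finally show ?thesis using S by linarith
    next
      case 3
      then obtain w' where w': "w' < M" "w' \<noteq> w" "\<theta> < lr \<sigma> n (x w') z"
        using threshold_decoder_error[OF M, of \<sigma> n \<theta> x z] by (auto simp: A_def)
      have "?l * indicator A z \<le> ?l * 1" by (simp add: indicator_def)
      also have "\<dots> \<le> ?l * (lr \<sigma> n (x w') z / \<theta>)"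
        using w' \<theta> l by (intro mult_left_mono) auto
      also have "\<dots> = 1 / \<theta> * (?l * lr \<sigma> n (x w') z)" by simp
      also have "\<dots> \<le> ?S"
        using w' \<theta> by (intro member_le_sum) auto
      also have "\<dots> \<le> ?B z" using l by simp
      finally show ?thesis .
    qed
  qed
  also have "\<dots> = \<theta> powr s * exp (((1 - s)\<^sup>2 - (1 - s)) * (\<Sum>i<n. (x w i)\<^sup>2) / (2 * \<sigma>\<^sup>2)) +
      (\<Sum>w'\<in>{..<M} - {w}. 1 / \<theta> * exp ((\<Sum>i<n. x w i * x w' i) / \<sigma>\<^sup>2))"
    by (intro has_bochner_integral_integral_eq has_bochner_integral_add has_bochner_integral_sum
        has_bochner_integral_mult_right lr_powr_integral[OF \<sigma>_pos] lr_mult_integral[OF \<sigma>_pos])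
  also have "(1 - s)\<^sup>2 - (1 - s) = - s * (1 - s)" by (simp add: power2_eq_square algebra_simps)
  finally show ?thesis by simp
qed

text \<open>Convexity of x ln x at the mixture of 1 and the product density \<open>H\<close>: the
  noise component contributes 1 ln 1 = 0, so only the weight 1 - q remains. Then ln \<open>H\<close>
  is a sum over letters, each bounded by the polynomial.\<close>

lemma bpsk_mixture_KL_le:
  assumes v: "0 \<le> v" "v \<le> 1" and q: "0 \<le> q" "q \<le> 1"
    and h: "\<And>z. h z = q + (1 - q) * (\<Prod>i<n. bpsk \<sigma> v (z i))"
    and int: "integrable (noise \<sigma> n) (\<lambda>z. h z * ln (h z))"
  shows "(\<integral>z. h z * ln (h z) \<partial>noise \<sigma> n) \<le> (1 - q) * (real n * (v ^ 4 / 4 + 2 * v ^ 6))"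
proof -
  define p where "p z = - v\<^sup>2 / 2 + lncosh_poly (v * z / \<sigma>)" for z
  define H where "H z = (\<Prod>i<n. bpsk \<sigma> v (z i))" for z
  have H: "0 < H z" for z unfolding H_def by (intro prod_pos) (simp add: bpsk_pos[OF \<sigma>_pos])
  have hb: "has_bochner_integral (noise \<sigma> n) (\<lambda>z. (1 - q) * (\<Sum>i<n. H z * p (z i)))
      ((1 - q) * (\<Sum>i<n. bpsk_div v))"
  proof (intro has_bochner_integral_mult_right has_bochner_integral_sum)
    fix i assume i: "i \<in> {..<n}"
    \<comment> \<open>Letter \<open>i\<close> carries the polynomial and contributes
      \<open>bpsk_div v\<close>; all other letters integrate to 1.\<close>
    have "has_bochner_integral (noise \<sigma> n)
        (\<lambda>z. \<Prod>j<n. (\<lambda>j z. if j = i then bpsk \<sigma> v z * p z else bpsk \<sigma> v z) j (z j))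
        (\<Prod>j<n. if j = i then bpsk_div v else 1)"
    proof (rule has_bochner_integral_noise_prod[OF \<sigma>_pos])
      fix j
      show "has_bochner_integral (gauss \<sigma>) (\<lambda>z. if j = i then bpsk \<sigma> v z * p z else bpsk \<sigma> v z)
         (if j = i then bpsk_div v else 1)"
        using bpsk_poly_integral[OF \<sigma>_pos, of v] bpsk_integral[OF \<sigma>_pos, of v]
        by (cases "j = i") (auto simp: p_def)
    qed
    moreover have "(\<Prod>j<n. if j = i then bpsk_div v else 1) = bpsk_div v"
      using i by simp
    moreover have "(\<Prod>j<n. if j = i then bpsk \<sigma> v (z j) * p (z j) else bpsk \<sigma> v (z j)) = H z * p (z i)" for z
    proof -
      have "(\<Prod>j<n. if j = i then bpsk \<sigma> v (z j) * p (z j) else bpsk \<sigma> v (z j)) =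
          (\<Prod>j<n. bpsk \<sigma> v (z j) * (if j = i then p (z j) else 1))"
        by (intro prod.cong) auto
      then show ?thesis using i by (simp add: prod.distrib H_def)
    qed
    ultimately show "has_bochner_integral (noise \<sigma> n) (\<lambda>z. H z * p (z i)) (bpsk_div v)"
      by simp
  qed
  have "(\<integral>z. h z * ln (h z) \<partial>noise \<sigma> n) \<le> (\<integral>z. (1 - q) * (\<Sum>i<n. H z * p (z i)) \<partial>noise \<sigma> n)"
  proof (rule integral_mono[OF int])
    show "integrable (noise \<sigma> n) (\<lambda>z. (1 - q) * (\<Sum>i<n. H z * p (z i)))"
      using hb by (simp add: has_bochner_integral_iff)
    fix z
    have hH: "h z = q + (1 - q) * H z" by (simp add: h H_def)
    have "0 \<le> (1 - q) * H z" using H[of z] q by (intro mult_nonneg_nonneg) auto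
    then have "0 < h z" using H[of z] q by (cases "q = 0") (simp_all add: hH add_pos_nonneg)
    \<comment> \<open>Tangent-line form of convexity at \<open>h z\<close>. As h - 1 = (1 - q) (H -
      1), the linear terms cancel when the two inequalities are added.\<close>
    have "q * ln (h z) \<le> q * (h z - 1)"
      using \<open>0 < h z\<close> q by (intro mult_left_mono ln_le_minus_one) auto
    moreover have "(1 - q) * (H z * ln (h z)) \<le> (1 - q) * (H z * ln (H z) - H z + h z)"
      using xlnx_young[of "H z" "ln (h z)"] H[of z] \<open>0 < h z\<close> q by (intro mult_left_mono) auto
    ultimately have "q * ln (h z) + (1 - q) * (H z * ln (h z)) \<le>
        q * (h z - 1) + (1 - q) * (H z * ln (H z) - H z + h z)"
      by (rule add_mono)
    also have "q * ln (h z) + (1 - q) * (H z * ln (h z)) = h z * ln (h z)"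
      unfolding hH by (simp add: algebra_simps)
    also have "q * (h z - 1) + (1 - q) * (H z * ln (H z) - H z + h z) = (1 - q) * (H z * ln (H z))"
      unfolding hH by (simp add: algebra_simps)
    finally have "h z * ln (h z) \<le> (1 - q) * (H z * ln (H z))" .
    also have "\<dots> \<le> (1 - q) * (\<Sum>i<n. H z * p (z i))"
    proof (rule mult_left_mono)
      have "ln (H z) = (\<Sum>i<n. ln (bpsk \<sigma> v (z i)))"
        unfolding H_def by (intro ln_prod) (simp_all add: bpsk_pos[OF \<sigma>_pos] less_imp_neq[OF bpsk_pos[OF \<sigma>_pos], symmetric])
      also have "\<dots> \<le> (\<Sum>i<n. p (z i))"
        unfolding p_def by (intro sum_mono ln_bpsk_le[OF \<sigma>_pos])
      finally show "H z * ln (H z) \<le> (\<Sum>i<n. H z * p (z i))"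
        using H[of z] by (simp add: sum_distrib_left[symmetric])
    qed (use q in simp)
    finally show "h z * ln (h z) \<le> (1 - q) * (\<Sum>i<n. H z * p (z i))" .
  qed
  also have "\<dots> = (1 - q) * (\<Sum>i<n. bpsk_div v)"
    using hb by (rule has_bochner_integral_integral_eq)
  also have "\<dots> \<le> (1 - q) * (real n * (v ^ 4 / 4 + 2 * v ^ 6))"
    using bpsk_div_le[OF \<sigma>_pos v] q by (simp add: mult_left_mono)
  finally show ?thesis .
qed

end

text \<open>A key is a codebook together with a flag. The \<open>m\<close> flags below
  \<open>m\<close> silence the transmitter: such keys spend the allowed error in order to save
  divergence.\<close>

definition bpsk_word :: "real \<Rightarrow> real \<Rightarrow> nat \<Rightarrow> nat \<Rightarrow> (nat \<times> nat \<Rightarrow> real) \<times> nat \<Rightarrow> nat \<Rightarrow> nat \<Rightarrow> real" where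
  "bpsk_word \<sigma> v n m k w = (\<lambda>i\<in>{..<n}. if snd k < m then 0 else v * \<sigma> * fst k (w, i))"

lemma sum_if_less:
  assumes "m \<le> N"
  shows "(\<Sum>j<N. if j < m then a else b) = real m * a + (real N - real m) * (b :: real)"
proof -
  have "(\<Sum>j<N. if j < m then a else b) = (\<Sum>j\<in>{..<N} \<inter> {j. j < m}. a) + (\<Sum>j\<in>{..<N} \<inter> - {j. j < m}. b)"
    by (subst sum.If_cases) auto
  moreover have "{..<N} \<inter> {j. j < m} = {..<m}" "{..<N} \<inter> - {j. j < m} = {m..<N}"
    using assms by auto
  ultimately show ?thesis using assms by (simp add: of_nat_diff)
qed

section \<open>The antipodal code with silent keys\<close>

context
  fixes \<sigma> :: real
  assumes \<sigma>_pos: "0 < \<sigma>"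
begin

text \<open>Random coding is carried out exactly by averaging over the keys. Silent keys cost error
  at most m / N and scale the divergence bound by 1 - m / N; the others obey the threshold-decoder
  bound, whose pair terms average to cosh (v^2) ^ n / \<theta>.\<close>

lemma is_code_bpsk:
  assumes M: "0 < M" and N: "0 < N" "m \<le> N" and v: "0 \<le> v" "v \<le> 1" and \<theta>: "0 < \<theta>" and s: "0 \<le> s"
    and err: "real m / real N + \<theta> powr s * exp (- s * (1 - s) * (real n * v\<^sup>2) / 2) +
      real M / \<theta> * cosh (v\<^sup>2) ^ n \<le> \<epsilon>"
    and div: "(1 - real m / real N) * (real n * (v ^ 4 / 4 + 2 * v ^ 6)) \<le> \<delta>"
  shows "is_code \<sigma> n M \<epsilon> \<delta>"
proof -
  let ?K = "codebooks M n \<times> {..<N}"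
  let ?x = "bpsk_word \<sigma> v n m"
  let ?C = "real (card (codebooks M n))"
  have C: "0 < ?C" by (simp add: card_codebooks)
  have cardK: "real (card ?K) = ?C * real N" by (simp add: card_cartesian_product)
  define e where "e k w = measure (noise \<sigma> n) {z \<in> space (noise \<sigma> n).
      threshold_decoder \<sigma> n M \<theta> (?x k) (vec_add n (?x k w) z) \<noteq> w}" for k w
  define a where "a = \<theta> powr s * exp (- s * (1 - s) * (real n * v\<^sup>2) / 2)"
  define b where "b = real M / \<theta> * cosh (v\<^sup>2) ^ n"
  interpret prob_space "noise \<sigma> n" by (rule prob_space_noise[OF \<sigma>_pos])
  have zero: "e (c, j) w \<le> 1" for c j w by (simp add: e_def)
  have nonzero: "e (c, j) w \<le> a + (\<Sum>w'\<in>{..<M} - {w}. exp (v\<^sup>2 * (\<Sum>i<n. c (w, i) * c (w', i))) / \<theta>)"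
    if c: "c \<in> codebooks M n" and j: "\<not> j < m" and w: "w < M" for c j w
  proof -
    \<comment> \<open>Signs square to 1, so all codewords have the same energy and the Chernoff term
      does not depend on the codebook.\<close>
    have "(\<Sum>i<n. (?x (c, j) w i)\<^sup>2) = (\<Sum>i<n. v\<^sup>2 * \<sigma>\<^sup>2)"
    proof (rule sum.cong)
      fix i assume "i \<in> {..<n}"
      then show "(?x (c, j) w i)\<^sup>2 = v\<^sup>2 * \<sigma>\<^sup>2"
        using codebooks_values[OF c w, of i] j
        by (auto simp: bpsk_word_def power_mult_distrib)
    qed simp
    then have 1: "(\<Sum>i<n. (?x (c, j) w i)\<^sup>2) / (2 * \<sigma>\<^sup>2) = real n * v\<^sup>2 / 2"
      using \<sigma>_pos by simp
    have 2: "(\<Sum>i<n. ?x (c, j) w i * ?x (c, j) w' i) / \<sigma>\<^sup>2 = v\<^sup>2 * (\<Sum>i<n. c (w, i) * c (w', i))" for w'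
      unfolding sum_divide_distrib sum_distrib_left using j \<sigma>_pos
      by (intro sum.cong) (auto simp: bpsk_word_def power2_eq_square)
    have 3: "- s * (1 - s) * (\<Sum>i<n. (?x (c, j) w i)\<^sup>2) / (2 * \<sigma>\<^sup>2) = - s * (1 - s) * (real n * v\<^sup>2) / 2"
      using arg_cong[OF 1, of "\<lambda>t. - s * (1 - s) * t"] by simp
    show ?thesis
      using threshold_decoder_error_prob[OF \<sigma>_pos w \<theta> s, of n "?x (c, j)"]
      unfolding e_def a_def 2 3 .
  qed
  have sum_c: "(\<Sum>c\<in>codebooks M n. \<Sum>w<M. e (c, j) w) \<le>
      (if j < m then ?C * real M else ?C * real M * (a + b))" for j
  proof (cases "j < m")
    case True
    have "(\<Sum>c\<in>codebooks M n. \<Sum>w<M. e (c, j) w) \<le> (\<Sum>c\<in>codebooks M n. \<Sum>w<M. 1)"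
      by (intro sum_mono zero)
    then show ?thesis using True by simp
  next
    case False
    have "(\<Sum>c\<in>codebooks M n. \<Sum>w<M. e (c, j) w) \<le> (\<Sum>c\<in>codebooks M n. \<Sum>w<M.
        a + (\<Sum>w'\<in>{..<M} - {w}. exp (v\<^sup>2 * (\<Sum>i<n. c (w, i) * c (w', i))) / \<theta>))"
      using False by (intro sum_mono nonzero) auto
    also have "\<dots> = (\<Sum>w<M. \<Sum>c\<in>codebooks M n.
        a + (\<Sum>w'\<in>{..<M} - {w}. exp (v\<^sup>2 * (\<Sum>i<n. c (w, i) * c (w', i))) / \<theta>))"
      by (rule sum.swap)
    also have "\<dots> \<le> (\<Sum>w<M. ?C * (a + b))"
    proof (rule sum_mono)
      fix w assume w: "w \<in> {..<M}"
      have "(\<Sum>c\<in>codebooks M n. \<Sum>w'\<in>{..<M} - {w}. exp (v\<^sup>2 * (\<Sum>i<n. c (w, i) * c (w', i))) / \<theta>) =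
         (\<Sum>w'\<in>{..<M} - {w}. (\<Sum>c\<in>codebooks M n. exp (v\<^sup>2 * (\<Sum>i<n. c (w, i) * c (w', i)))) / \<theta>)"
        unfolding sum_divide_distrib by (rule sum.swap)
      also have "\<dots> = (\<Sum>w'\<in>{..<M} - {w}. ?C * cosh (v\<^sup>2) ^ n / \<theta>)"
        using w by (intro sum.cong) (auto simp: sum_codebooks_pair)
      also have "\<dots> = real (card ({..<M} - {w})) * (?C * cosh (v\<^sup>2) ^ n / \<theta>)"
        by simp
      also have "\<dots> \<le> real M * (?C * cosh (v\<^sup>2) ^ n / \<theta>)"
        using w C \<theta> by (intro mult_right_mono divide_nonneg_pos mult_nonneg_nonneg) auto
      also have "\<dots> = ?C * b" by (simp add: b_def)
      finally show "(\<Sum>c\<in>codebooks M n. a + (\<Sum>w'\<in>{..<M} - {w}.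
          exp (v\<^sup>2 * (\<Sum>i<n. c (w, i) * c (w', i))) / \<theta>)) \<le> ?C * (a + b)"
        by (simp add: sum.distrib distrib_left)
    qed
    finally show ?thesis using False by (simp add: mult_ac)
  qed
  have ab: "0 \<le> a + b" using \<theta> by (simp add: a_def b_def)
  have "(\<Sum>k\<in>?K. \<Sum>w<M. e k w) = (\<Sum>c\<in>codebooks M n. \<Sum>j<N. \<Sum>w<M. e (c, j) w)"
    by (subst sum.cartesian_product) (simp add: case_prod_unfold)
  also have "\<dots> = (\<Sum>j<N. \<Sum>c\<in>codebooks M n. \<Sum>w<M. e (c, j) w)"
    by (rule sum.swap)
  also have "\<dots> \<le> (\<Sum>j<N. if j < m then ?C * real M else ?C * real M * (a + b))"
    by (intro sum_mono sum_c)
  also have "\<dots> = real m * (?C * real M) + (real N - real m) * (?C * real M * (a + b))"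
    using N by (intro sum_if_less)
  also have "\<dots> \<le> real m * (?C * real M) + real N * (?C * real M * (a + b))"
    using ab C by (intro add_left_mono mult_right_mono) auto
  also have "\<dots> = (real m / real N + (a + b)) * (?C * real N * real M)"
    using N by (simp add: field_simps)
  also have "\<dots> \<le> \<epsilon> * (?C * real N * real M)"
    using err C by (intro mult_right_mono) (auto simp: a_def b_def)
  finally have e: "(\<Sum>k\<in>?K. \<Sum>w<M. e k w) \<le> \<epsilon> * (real (card ?K) * real M)"
    unfolding cardK .
  define q where "q = real m / real N"
  have q: "0 \<le> q" "q \<le> 1" using N by (auto simp: q_def)
  let ?h = "mixture \<sigma> n {..<M} ?K (\<lambda>(w, k). ?x k w)"
  \<comment> \<open>The output density is exactly a mixture of noise and the i.i.d. antipodal law: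
    each row of a uniform codebook is a uniform sign vector, whatever the message.\<close>
  have h: "?h z = q + (1 - q) * (\<Prod>i<n. bpsk \<sigma> v (z i))" for z
  proof -
    let ?H = "\<Prod>i<n. bpsk \<sigma> v (z i)"
    have row: "(\<Sum>c\<in>codebooks M n. lr \<sigma> n (?x (c, j) w) z) = (if j < m then ?C else ?C * ?H)"
      if "w < M" for w j
    proof (cases "j < m")
      case True
      then have "?x (c, j) w = (\<lambda>i\<in>{..<n}. 0)" for c by (auto simp: bpsk_word_def)
      then show ?thesis using True by simp
    next
      case False
      have "(\<Sum>c\<in>codebooks M n. lr \<sigma> n (?x (c, j) w) z) = (\<Sum>c\<in>codebooks M n. \<Prod>i<n.
          exp ((v * \<sigma> * c (w, i) * z i - (v * \<sigma> * c (w, i))\<^sup>2 / 2) / \<sigma>\<^sup>2))"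
        unfolding lr_def using False by (intro sum.cong prod.cong) (auto simp: bpsk_word_def)
      also have "\<dots> = ?C * (\<Prod>i<n. (exp ((v * \<sigma> * 1 * z i - (v * \<sigma> * 1)\<^sup>2 / 2) / \<sigma>\<^sup>2) +
          exp ((v * \<sigma> * -1 * z i - (v * \<sigma> * -1)\<^sup>2 / 2) / \<sigma>\<^sup>2)) / 2)"
        by (rule sum_codebooks_row[OF that,
            where F="\<lambda>i s. exp ((v * \<sigma> * s * z i - (v * \<sigma> * s)\<^sup>2 / 2) / \<sigma>\<^sup>2)"])
      finally show ?thesis using False by (simp add: bpsk_def)
    qed
    have "(\<Sum>k\<in>?K. \<Sum>w<M. lr \<sigma> n (?x k w) z) = (\<Sum>c\<in>codebooks M n. \<Sum>j<N. \<Sum>w<M. lr \<sigma> n (?x (c, j) w) z)"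
      by (subst sum.cartesian_product) (simp add: case_prod_unfold)
    also have "\<dots> = (\<Sum>j<N. \<Sum>w<M. \<Sum>c\<in>codebooks M n. lr \<sigma> n (?x (c, j) w) z)"
      by (subst sum.swap) (intro sum.cong refl sum.swap)
    also have "\<dots> = (\<Sum>j<N. if j < m then real M * ?C else real M * (?C * ?H))"
      using row by (intro sum.cong) auto
    also have "\<dots> = real m * (real M * ?C) + (real N - real m) * (real M * (?C * ?H))"
      using N by (intro sum_if_less)
    also have "\<dots> = (?C * real N * real M) * (q + (1 - q) * ?H)"
      using N by (simp add: q_def field_simps)
    finally have "(\<Sum>k\<in>?K. \<Sum>w<M. lr \<sigma> n (?x k w) z) = (?C * real N * real M) * (q + (1 - q) * ?H)" .
    moreover have "?h z = 1 / (?C * real N * real M) * (\<Sum>k\<in>?K. \<Sum>w<M. lr \<sigma> n (?x k w) z)"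
      unfolding mixture_def cardK by simp
    ultimately show ?thesis using C N M codebooks_nonempty[of M n] by simp
  qed
  have int: "integrable (noise \<sigma> n) (\<lambda>z. ?h z * ln (?h z))"
    by (rule integrable_xlnx[OF \<sigma>_pos], measurable, rule mixture_nonneg,
        rule mixture_square_integrable[OF \<sigma>_pos])
  show ?thesis
  proof (rule is_codeI[OF \<sigma>_pos, where K="?K" and x="?x" and d="\<lambda>k. threshold_decoder \<sigma> n M \<theta> (?x k)"])
    show "?K \<noteq> {}" using codebooks_nonempty N by auto
    show "?x k w \<in> space (euclid n)" for k w by (simp add: space_euclid bpsk_word_def)
    show "threshold_decoder \<sigma> n M \<theta> (?x k) \<in> measurable (euclid n) (count_space {..<M})" for k
      by (rule threshold_decoder_measurable[OF M])
    show "(\<integral>z. ?h z * ln (?h z) \<partial>noise \<sigma> n) \<le> \<delta>"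
      using bpsk_mixture_KL_le[OF \<sigma>_pos v q h int] div by (simp add: q_def)
  qed (use M e in \<open>auto simp: e_def\<close>)
qed

end

section \<open>Asymptotics\<close>

text \<open>The silent fraction is rational, being a proportion of finitely many keys. Slightly
  below \<epsilon>, it leaves room both for the vanishing error terms and for some \<open>u\<close>
  above \<open>r\<close> within the divergence budget.\<close>

lemma code_parameters:
  fixes \<epsilon> \<delta> r :: real
  assumes "0 < \<epsilon>" "\<epsilon> < 1" "0 < \<delta>" "0 \<le> r" "r < sqrt \<delta> / sqrt (1 - \<epsilon>)"
  obtains m N :: nat and u where "0 < N" "m \<le> N" "real m / real N < \<epsilon>" "r < u"
    "(1 - real m / real N) * u\<^sup>2 < \<delta>"
proof -
  have "r\<^sup>2 < (sqrt \<delta> / sqrt (1 - \<epsilon>))\<^sup>2"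
    using assms by (intro power_strict_mono) auto
  then have r2: "r\<^sup>2 * (1 - \<epsilon>) < \<delta>"
    using assms by (simp add: power_divide field_simps)
  \<comment> \<open>Chosen so that r^2 (1 - \<epsilon>) + (r^2 + 1) \<kappa> = \<delta>; the added 1
    avoids a zero denominator at r = 0 and makes the estimate below strict.\<close>
  define \<kappa> where "\<kappa> = (\<delta> - r\<^sup>2 * (1 - \<epsilon>)) / (r\<^sup>2 + 1)"
  have \<kappa>: "0 < \<kappa>" using r2 by (simp add: \<kappa>_def add_nonneg_pos)
  obtain q where q: "q \<in> \<rat>" "max 0 (\<epsilon> - \<kappa>) < q" "q < \<epsilon>"
    using Rats_dense_in_real[of "max 0 (\<epsilon> - \<kappa>)" \<epsilon>] assms \<kappa> by auto
  obtain m N :: nat where mN: "N \<noteq> 0" "\<bar>q\<bar> = real m / real N"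
    using Rats_abs_nat_div_natE[OF q(1)] by metis
  then have qmN: "q = real m / real N" using q by simp
  have "r\<^sup>2 * (1 - q) \<le> r\<^sup>2 * (1 - \<epsilon> + \<kappa>)"
    using q by (intro mult_left_mono) auto
  also have "\<dots> < r\<^sup>2 * (1 - \<epsilon>) + (r\<^sup>2 + 1) * \<kappa>"
    using \<kappa> by (simp add: algebra_simps)
  also have "\<dots> = \<delta>" by (simp add: \<kappa>_def add_nonneg_eq_0_iff)
  finally have "r\<^sup>2 < \<delta> / (1 - q)"
    using q assms by (simp add: pos_less_divide_eq)
  then have "r < sqrt (\<delta> / (1 - q))" by (rule real_less_rsqrt)
  then obtain u where u: "r < u" "u < sqrt (\<delta> / (1 - q))" using dense by blast
  have "u\<^sup>2 < (sqrt (\<delta> / (1 - q)))\<^sup>2"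
    using u assms by (intro power_strict_mono) auto
  then have "(1 - q) * u\<^sup>2 < \<delta>"
    using q assms by (simp add: field_simps)
  moreover have "real m / real N < 1" using qmN q assms by simp
  then have "m \<le> N" using mN by (simp add: divide_less_eq)
  ultimately show ?thesis using that[of N m u] mN qmN q u by simp
qed

text \<open>Three rates are nested, in units of sqrt n: \<open>r\<close> for the number of messages,
  \<open>t\<close> for the log threshold, \<open>u\<close> for the mean log-likelihood ratio of the
  true codeword. The gap from \<open>r\<close> to \<open>t\<close> suppresses false alarms, the gap
  from \<open>t\<close> to \<open>u\<close> misses.\<close>

lemma eventually_is_code:
  fixes \<sigma> \<epsilon> \<delta> r :: real
  assumes \<sigma>: "0 < \<sigma>" and "0 < \<epsilon>" "\<epsilon> < 1" "0 < \<delta>" and r: "0 \<le> r" "r < sqrt \<delta> / sqrt (1 - \<epsilon>)"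
  shows "eventually (\<lambda>n. \<exists>M. is_code \<sigma> n M \<epsilon> \<delta> \<and> exp (r * sqrt (real n)) \<le> real M) sequentially"
proof -
  obtain m N :: nat and u where N: "0 < N" "m \<le> N" and q_less: "real m / real N < \<epsilon>" and u: "r < u"
    and div: "(1 - real m / real N) * u\<^sup>2 < \<delta>"
    by (rule code_parameters[OF assms(2-4) r])
  define q where "q = real m / real N"
  obtain t where t: "r < t" "t < u" using dense[OF u] by blast
  \<comment> \<open>Minimiser of s t - s (1 - s) u, the Chernoff exponent per sqrt n; the minimum is
    - s^2 u.\<close>
  define s where "s = (1 - t / u) / 2"
  have pos: "0 < u" "0 < t" "0 < s" using u t r by (auto simp: s_def)
  have t_eq: "t = u - 2 * s * u" using pos by (simp add: s_def field_simps)
  \<comment> \<open>\<open>A\<close> and \<open>B\<close> are the decay rates of misses and false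
    alarms; \<open>D\<close> bounds the cosh factor uniformly in \<open>n\<close>.\<close>
  define A where "A = s\<^sup>2 * u"
  define B where "B = t - r"
  define D where "D = exp (2 * u\<^sup>2)"
  have "0 < A" "0 < B" using pos t by (auto simp: A_def B_def)
  have lim: "(\<lambda>n::nat. exp (- (x * sqrt (real n)))) \<longlonglongrightarrow> 0" if "0 < x" for x :: real
    using that by real_asymp
  have "(\<lambda>n::nat. q + exp (- (A * sqrt (real n))) +
      (exp (- (B * sqrt (real n))) + exp (- (t * sqrt (real n)))) * D) \<longlonglongrightarrow> q + 0 + (0 + 0) * D"
    by (intro tendsto_intros lim \<open>0 < A\<close> \<open>0 < B\<close> \<open>0 < t\<close>)
  then have E1: "eventually (\<lambda>n. q + exp (- (A * sqrt (real n))) +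
      (exp (- (B * sqrt (real n))) + exp (- (t * sqrt (real n)))) * D < \<epsilon>) sequentially"
    using q_less by (intro order_tendstoD(2)[where y="q + 0 + (0 + 0) * D"]) (auto simp: q_def)
  have "(\<lambda>n::nat. 1 / sqrt (real n)) \<longlonglongrightarrow> 0" by real_asymp
  then have "(\<lambda>n::nat. (1 - q) * (u\<^sup>2 + 16 * u ^ 3 * (1 / sqrt (real n)))) \<longlonglongrightarrow>
      (1 - q) * (u\<^sup>2 + 16 * u ^ 3 * 0)"
    by (intro tendsto_intros)
  then have E2: "eventually (\<lambda>n. (1 - q) * (u\<^sup>2 + 16 * u ^ 3 / sqrt (real n)) < \<delta>) sequentially"
    using div by (intro order_tendstoD(2)[where y="(1 - q) * (u\<^sup>2 + 16 * u ^ 3 * 0)"]) (auto simp: q_def)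
  have "filterlim (\<lambda>n::nat. sqrt (real n)) at_top sequentially" by real_asymp
  then have E3: "eventually (\<lambda>n. 2 * u \<le> sqrt (real n)) sequentially"
    by (simp add: filterlim_at_top)
  show ?thesis
    using E1 E2 E3
  proof eventually_elim
    case (elim n)
    define y where "y = sqrt (real n)"
    have "2 * u \<le> y" using elim(3) by (simp add: y_def)
    with pos(1) have y: "0 < y" "2 * u \<le> y" by linarith+
    have ny: "real n = y\<^sup>2" by (simp add: y_def)
    \<comment> \<open>The square-root law: n v^2 / 2 = u sqrt n while n v^4 / 4 = u^2, so the rate
      grows like sqrt n at bounded divergence.\<close>
    define v where "v = sqrt (2 * u / y)"
    have v2: "v\<^sup>2 = 2 * u / y" using pos y by (simp add: v_def)
    have v4: "v ^ 4 = (2 * u / y)\<^sup>2" and v6: "v ^ 6 = (2 * u / y) ^ 3"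
      unfolding v2[symmetric] by (simp_all add: power_mult[symmetric])
    have v: "0 \<le> v" "v \<le> 1" using y pos by (auto simp: v_def)
    define M where "M = nat \<lceil>exp (r * y)\<rceil>"
    have M: "exp (r * y) \<le> real M" "real M \<le> exp (r * y) + 1"
      unfolding M_def using exp_gt_zero[of "r * y"] by linarith+
    have "0 < M" using M(1) exp_gt_zero[of "r * y"] by (cases "M = 0") auto
    have "is_code \<sigma> n M \<epsilon> \<delta>"
    proof (rule is_code_bpsk[OF \<sigma> \<open>0 < M\<close> N v])
      have "exp (t * y) powr s * exp (- s * (1 - s) * (real n * v\<^sup>2) / 2) = exp (- (A * y))"
      proof -
        have "real n * v\<^sup>2 = 2 * u * y" unfolding ny v2 using y by (simp add: power2_eq_square)
        then have "t * y * s + - s * (1 - s) * (real n * v\<^sup>2) / 2 = (t - u + s * u) * (y * s)"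
          by (simp add: algebra_simps diff_divide_distrib)
        also have "\<dots> = - (A * y)"
          by (simp add: t_eq A_def algebra_simps power2_eq_square)
        finally have "t * y * s + - s * (1 - s) * (real n * v\<^sup>2) / 2 = - (A * y)" .
        then show ?thesis by (simp add: powr_def exp_add[symmetric] mult.commute)
      qed
      moreover have "real M / exp (t * y) * cosh (v\<^sup>2) ^ n \<le> (exp (- (B * y)) + exp (- (t * y))) * D"
      proof -
        \<comment> \<open>The exponent n (v^2)^2 / 2 equals 2 u^2 for every n, so correlations
          between random codewords cost only a constant factor.\<close>
        have "cosh (v\<^sup>2) ^ n \<le> exp ((v\<^sup>2)\<^sup>2 / 2) ^ n"
          by (intro power_mono cosh_le_exp_square) (simp add: cosh_real_nonneg)
        also have "\<dots> = exp (real n * ((v\<^sup>2)\<^sup>2 / 2))" by (simp only: exp_of_nat_mult)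
        also have "real n * ((v\<^sup>2)\<^sup>2 / 2) = 2 * u\<^sup>2"
          unfolding ny v2 using y by (simp add: power_divide power_mult_distrib)
        finally have c: "cosh (v\<^sup>2) ^ n \<le> D" by (simp add: D_def)
        have "real M / exp (t * y) \<le> (exp (r * y) + 1) / exp (t * y)"
          using M by (intro divide_right_mono) auto
        also have "\<dots> = exp (- (B * y)) + exp (- (t * y))"
        proof -
          have "exp (- (B * y)) = exp (r * y) / exp (t * y)"
            by (simp add: B_def exp_diff[symmetric] left_diff_distrib)
          moreover have "exp (- (t * y)) = 1 / exp (t * y)"
            by (simp add: exp_minus divide_inverse)
          ultimately show ?thesis by (simp only: add_divide_distrib)
        qed
        finally show ?thesis
          using c by (intro mult_mono) (auto simp: cosh_real_nonneg)
      qed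
      ultimately show "real m / real N + exp (t * y) powr s * exp (- s * (1 - s) * (real n * v\<^sup>2) / 2) +
          real M / exp (t * y) * cosh (v\<^sup>2) ^ n \<le> \<epsilon>"
        using elim(1) unfolding q_def y_def by linarith
      have "real n * (v ^ 4 / 4 + 2 * v ^ 6) = u\<^sup>2 + 16 * u ^ 3 / y"
        unfolding ny v4 v6 using y
        by (simp add: field_simps power2_eq_square power3_eq_cube)
      then show "(1 - real m / real N) * (real n * (v ^ 4 / 4 + 2 * v ^ 6)) \<le> \<delta>"
        using elim(2) unfolding q_def y_def by simp
    qed (use pos in auto)
    then show ?case using M by (auto simp: y_def)
  qed
qed

text \<open>The lower limit is tested against each smaller \<open>l\<close>: codes of a rate
  \<open>r'\<close> between \<open>l\<close> and the claimed value exist for all large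
  \<open>n\<close>, and finiteness of the admissible sizes turns them into lower bounds on
  \<open>M_star\<close>.\<close>

theorem proposition2:
  fixes \<sigma> \<epsilon> \<delta> :: real
  assumes "\<sigma> > 0"
    and "0 < \<epsilon>" and "\<epsilon> < 1"
    and "0 < \<delta>" and "\<delta> \<le> 1"
  shows "covert_capacity \<sigma> \<epsilon> \<delta> \<ge> ereal (sqrt \<delta> / sqrt (1 - \<epsilon>))"
  unfolding covert_capacity_def le_Liminf_iff
proof (intro allI impI)
  fix l assume "l < ereal (sqrt \<delta> / sqrt (1 - \<epsilon>))"
  then obtain r where r: "l < ereal r" "r < sqrt \<delta> / sqrt (1 - \<epsilon>)"
    using ereal_dense2 by (metis less_ereal.simps(1))
  \<comment> \<open>The bound \<open>l\<close> may be negative or - \<infinity>, whereas the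
    construction takes a nonnegative rate.\<close>
  define r' where "r' = max r 0"
  have r': "0 \<le> r'" "r' < sqrt \<delta> / sqrt (1 - \<epsilon>)"
    using r assms by (auto simp: r'_def)
  have "ereal r \<le> ereal r'" by (simp add: r'_def)
  with r(1) have l: "l < ereal r'" by (rule less_le_trans)
  show "eventually (\<lambda>n. l < ereal (ln (real (M_star \<sigma> n \<epsilon> \<delta>)) / sqrt (real n))) sequentially"
    using eventually_is_code[OF assms(1-4) r'(1,2)] eventually_gt_at_top[of 0]
  proof eventually_elim
    case (elim n)
    then obtain M where M: "is_code \<sigma> n M \<epsilon> \<delta>" "exp (r' * sqrt (real n)) \<le> real M" by blast
    have "M \<le> M_star \<sigma> n \<epsilon> \<delta>"
      unfolding M_star_def using M(1) assms
      by (intro Max_ge finite_is_code) auto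
    then have le: "exp (r' * sqrt (real n)) \<le> real (M_star \<sigma> n \<epsilon> \<delta>)" using M(2) by linarith
    then have "r' * sqrt (real n) \<le> ln (real (M_star \<sigma> n \<epsilon> \<delta>))"
      using exp_gt_zero[of "r' * sqrt (real n)"] by (subst ln_ge_iff) linarith+
    then have "r' \<le> ln (real (M_star \<sigma> n \<epsilon> \<delta>)) / sqrt (real n)"
      using elim by (simp add: pos_le_divide_eq)
    then show ?case using l by (simp add: less_le_trans[of l "ereal r'"])
  qed
qed

end
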